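(* Let $f\in M[0,\infty)$ be a nonconstant function, and let $\tau$ be the finite positive Borel measure on $[0,+\infty)$ with $f(t)=\int_0^\infty e^{-ts}\,d\tau(s)$ for all $t\in[0,+\infty)$. Let $X=\{x_k\}_{k=1}^\infty$ be a sequence of points of $\mathbb{R}^3$. Then: (i) If $d_*(X)>0$, then the function $x\mapsto f(|x|)$ on $\mathbb{R}^3$ is strongly $X$-positive definite. (ii) If $d_*(X)>0$ and $\int_0^\infty (s+s^{-3})\,d\tau(s)<\infty$, then the Gram matrix $Gr_X(f)=\big(f(|x_k-x_j|)\big)_{k,j\in\mathbb{N}}$ defines a bounded operator with bounded inverse on $l^2(\mathbb{N})$. (iii) If the Gram matrix $Gr_X(f)$ defines a bounded operator with bounded inverse on $l^2(\mathbb{N})$, then $d_*(X)>0$.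
   Context: $M[0,\infty)$ denotes the set of completely monotone functions on $[0,\infty)$: bounded continuous functions $f$ on $[0,\infty)$ that are $C^\infty$ on $(0,\infty)$ and satisfy $(-1)^kf^{(k)}(t)\ge 0$ for all integers $k\ge 0$ and all $t>0$. By Bernstein's theorem each such $f$ has a unique representing finite positive Borel measure $\tau$ on $[0,\infty)$ with $f(t)=\int_0^\infty e^{-ts}d\tau(s)$. For a sequence $X=\{x_k\}_1^\infty$ in $\mathbb{R}^n$, $d_*(X):=\inf_{k\ne j}|x_k-x_j|$. A positive definite function $g$ on $\mathbb{R}^n$ is strongly $X$-positive definite if there is a constant $c>0$ such that $\sum_{j,k=1}^m\xi_k\overline{\xi_j}\,g(x_k-x_j)\ge c\sum_{k=1}^m|\xi_k|^2$ for all $m\in\mathbb{N}$ and $\xi_1,\dots,\xi_m\in\mathbb{C}$. An infinite matrix $(a_{kj})_{k,j\in\mathbb{N}}$ defines a bounded operator $A$ on $l^2(\mathbb{N})$ if $\langle Ax,y\rangle=\sum_{k,j}a_{kj}x_k\overline{y_j}$ for all $x,y\in l^2(\mathbb{N})$. *)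

theory Defs
  imports "HOL-Analysis.Analysis" "HOL-Library.Complex_Order"
begin

(* The real type carries functions on [0,\<infinity>): only the values on {0..} are constrained,
   and the iterated derivatives at t > 0 depend on these values only. *)
definition completely_monotone :: "(real \<Rightarrow> real) set" where
  "completely_monotone =
     {f. bounded (f ` {0..}) \<and> continuous_on {0..} f \<and>
         (\<forall>k. \<forall>t>0. (deriv ^^ k) f field_differentiable (at t)) \<and>
         (\<forall>k. \<forall>t>0. (- 1) ^ k * (deriv ^^ k) f t \<ge> 0)}"

definition separation :: "(nat \<Rightarrow> real ^ 'n) \<Rightarrow> real" where
  "separation X = Inf {norm (X k - X j) | k j. k \<noteq> j}"

(* The order on complex is the one of Complex_Order: 0 \<le> z means that z is real and
   nonnegative.  Continuity at 0 is part of the usual definition of a positive definite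
   function on R^n. *)
definition positive_definite :: "(real ^ 'n \<Rightarrow> complex) \<Rightarrow> bool" where
  "positive_definite g \<longleftrightarrow>
     isCont g 0 \<and>
     (\<forall>m (x :: nat \<Rightarrow> real ^ 'n) (\<xi> :: nat \<Rightarrow> complex).
        0 \<le> (\<Sum>j<m. \<Sum>k<m. \<xi> k * cnj (\<xi> j) * g (x k - x j)))"

definition strongly_positive_definite ::
    "(nat \<Rightarrow> real ^ 'n) \<Rightarrow> (real ^ 'n \<Rightarrow> complex) \<Rightarrow> bool" where
  "strongly_positive_definite X g \<longleftrightarrow>
     positive_definite g \<and>
     (\<exists>c::real. c > 0 \<and>
        (\<forall>m (\<xi> :: nat \<Rightarrow> complex).
           complex_of_real (c * (\<Sum>k<m. (cmod (\<xi> k))\<^sup>2)) \<le>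
             (\<Sum>j<m. \<Sum>k<m. \<xi> k * cnj (\<xi> j) * g (X k - X j))))"

definition l2 :: "(nat \<Rightarrow> complex) set" where
  "l2 = {x. summable (\<lambda>k. (cmod (x k))\<^sup>2)}"

definition l2_norm :: "(nat \<Rightarrow> complex) \<Rightarrow> real" where
  "l2_norm x = sqrt (\<Sum>k. (cmod (x k))\<^sup>2)"

definition l2_inner :: "(nat \<Rightarrow> complex) \<Rightarrow> (nat \<Rightarrow> complex) \<Rightarrow> complex" where
  "l2_inner x y = (\<Sum>k. x k * cnj (y k))"

(* Operators on l2 are functions on all sequences, constrained on the carrier only. *)
definition l2_bounded_operator :: "((nat \<Rightarrow> complex) \<Rightarrow> (nat \<Rightarrow> complex)) \<Rightarrow> bool" where
  "l2_bounded_operator A \<longleftrightarrow>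
     (\<forall>x\<in>l2. A x \<in> l2) \<and>
     (\<forall>x\<in>l2. \<forall>y\<in>l2. A (\<lambda>k. x k + y k) = (\<lambda>k. A x k + A y k)) \<and>
     (\<forall>c. \<forall>x\<in>l2. A (\<lambda>k. c * x k) = (\<lambda>k. c * A x k)) \<and>
     (\<exists>C. \<forall>x\<in>l2. l2_norm (A x) \<le> C * l2_norm x)"

definition l2_bounded_inverse :: "((nat \<Rightarrow> complex) \<Rightarrow> (nat \<Rightarrow> complex)) \<Rightarrow> bool" where
  "l2_bounded_inverse A \<longleftrightarrow>
     (\<exists>B. l2_bounded_operator B \<and> (\<forall>x\<in>l2. A (B x) = x \<and> B (A x) = x))"

(* The double series converges in the sense of its rectangular partial sums.  Unconditional
   convergence would exclude bounded operators such as the one with matrix 1 / (k - j) for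
   k \<noteq> j and zero diagonal. *)
definition matrix_defines_l2_operator ::
    "(nat \<Rightarrow> nat \<Rightarrow> complex) \<Rightarrow> ((nat \<Rightarrow> complex) \<Rightarrow> (nat \<Rightarrow> complex)) \<Rightarrow> bool" where
  "matrix_defines_l2_operator a A \<longleftrightarrow>
     l2_bounded_operator A \<and>
     (\<forall>x\<in>l2. \<forall>y\<in>l2.
        ((\<lambda>(M, N). \<Sum>k<M. \<Sum>j<N. a k j * x k * cnj (y j)) \<longlongrightarrow> l2_inner (A x) y)
          (sequentially \<times>\<^sub>F sequentially))"

definition gram_matrix ::
    "(nat \<Rightarrow> real ^ 'n) \<Rightarrow> (real \<Rightarrow> real) \<Rightarrow> nat \<Rightarrow> nat \<Rightarrow> complex" where
  "gram_matrix X f k j = complex_of_real (f (norm (X k - X j)))"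

end

theory Submission
  imports Defs "HOL-Probability.Distributions" "HOL-Probability.Distribution_Functions"
    "HOL-Real_Asymp.Real_Asymp"
begin

text \<open>The identity \<open>\<integral>\<^sub>0\<^sup>\<infinity> exp (- v\<^sup>2 - a\<^sup>2 / v\<^sup>2) dv = (sqrt pi / 2) exp (- 2 a)\<close> writes
  \<open>exp (- s |x|)\<close> as a mixture of Gaussians \<open>exp (- t |x|\<^sup>2)\<close>. Every Gaussian is positive definite,
  and on a separated sequence the Gram matrices with large \<open>t\<close> are uniformly diagonally dominant.
  Hence \<open>exp (- s |x|)\<close>, and after integration against \<open>\<tau>\<close> also \<open>f |x|\<close>, is strongly
  \<open>X\<close>-positive definite. Counting the points of \<open>X\<close> in cubes
  bounds the row sums of the Gram matrix by a multiple of \<open>\<integral> (1 + s\<^sup>-\<^sup>3) d\<tau>\<close>, so that the Schur test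
  gives a bounded operator, which is invertible by coercivity. Conversely, a bounded positive \<open>A\<close>
  satisfies \<open>|A x|\<^sup>2 \<le> |A| \<langle>A x, x\<rangle>\<close>; for a difference \<open>x\<close> of two unit vectors the right-hand side
  is \<open>2 |A| (f 0 - f |x\<^sub>i - x\<^sub>j|)\<close>, which must stay away from \<open>0\<close> if \<open>A\<close> has a bounded inverse.\<close>

section \<open>Gaussian kernels\<close>

text \<open>Expanding one factor of the inner product in coordinates splits the form for
  \<open>Suc n\<close> into forms for \<open>n\<close> whose weights have absorbed a coordinate of
  \<open>x\<close>. The induction therefore has to run over all \<open>u\<close>.\<close>

lemma sum_inner_power_nonneg:
  fixes x :: "'i \<Rightarrow> 'a::euclidean_space" and u :: "'i \<Rightarrow> real"
  shows "0 \<le> (\<Sum>j\<in>I. \<Sum>k\<in>I. u k * u j * (x k \<bullet> x j) ^ n)"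
proof (induction n arbitrary: u)
  case 0
  have "(\<Sum>j\<in>I. \<Sum>k\<in>I. u k * u j * (x k \<bullet> x j) ^ 0) = (\<Sum>k\<in>I. u k)\<^sup>2"
    by (simp add: power2_eq_square sum_product mult.commute)
  then show ?case
    by simp
next
  case (Suc n)
  have "(\<Sum>j\<in>I. \<Sum>k\<in>I. u k * u j * (x k \<bullet> x j) ^ Suc n) =
      (\<Sum>j\<in>I. \<Sum>k\<in>I. \<Sum>b\<in>Basis. (u k * (x k \<bullet> b)) * (u j * (x j \<bullet> b)) * (x k \<bullet> x j) ^ n)"
    by (subst power_Suc, subst (1) euclidean_inner)
       (simp add: sum_distrib_left sum_distrib_right mult_ac)
  also have "\<dots> = (\<Sum>b\<in>Basis. \<Sum>j\<in>I. \<Sum>k\<in>I.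
      (u k * (x k \<bullet> b)) * (u j * (x j \<bullet> b)) * (x k \<bullet> x j) ^ n)"
    by (simp add: sum.swap[where B = Basis])
  also have "\<dots> \<ge> 0"
    by (intro sum_nonneg Suc.IH)
  finally show ?case .
qed

text \<open>Expanding |x - y|^2 moves the factors exp(-t |x|^2) into the weights. What remains is
  exp(2 t (x, y)), a power series in the inner product with nonnegative coefficients, so positivity
  follows term by term.\<close>

lemma gaussian_form_nonneg:
  fixes x :: "'i \<Rightarrow> 'a::euclidean_space" and u :: "'i \<Rightarrow> real"
  assumes "t \<ge> 0"
  shows "0 \<le> (\<Sum>j\<in>I. \<Sum>k\<in>I. u k * u j * exp (- (t * (norm (x k - x j))\<^sup>2)))"
proof -
  define v where "v k = u k * exp (- (t * (norm (x k))\<^sup>2))" for k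
  have split: "u k * u j * exp (- (t * (norm (x k - x j))\<^sup>2)) =
      v k * v j * exp (2 * t * (x k \<bullet> x j))" for k j
  proof -
    have "- (t * (norm (x k - x j))\<^sup>2) =
        - (t * (norm (x k))\<^sup>2) + - (t * (norm (x j))\<^sup>2) + 2 * t * (x k \<bullet> x j)"
      by (simp add: power2_norm_eq_inner inner_diff inner_commute algebra_simps)
    then show ?thesis
      by (simp only: exp_add v_def mult_ac)
  qed
  have "(\<lambda>n. \<Sum>j\<in>I. \<Sum>k\<in>I. v k * v j * ((2 * t * (x k \<bullet> x j)) ^ n /\<^sub>R fact n)) sums
      (\<Sum>j\<in>I. \<Sum>k\<in>I. v k * v j * exp (2 * t * (x k \<bullet> x j)))"
    by (intro sums_sum sums_mult exp_converges)
  also have "(\<lambda>n. \<Sum>j\<in>I. \<Sum>k\<in>I. v k * v j * ((2 * t * (x k \<bullet> x j)) ^ n /\<^sub>R fact n)) =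
      (\<lambda>n. ((2 * t) ^ n / fact n) * (\<Sum>j\<in>I. \<Sum>k\<in>I. v k * v j * (x k \<bullet> x j) ^ n))"
    by (simp add: sum_distrib_left power_mult_distrib field_simps)
  finally have "(\<lambda>n. ((2 * t) ^ n / fact n) * (\<Sum>j\<in>I. \<Sum>k\<in>I. v k * v j * (x k \<bullet> x j) ^ n)) sums
      (\<Sum>j\<in>I. \<Sum>k\<in>I. v k * v j * exp (2 * t * (x k \<bullet> x j)))" .
  then have "0 \<le> (\<Sum>j\<in>I. \<Sum>k\<in>I. v k * v j * exp (2 * t * (x k \<bullet> x j)))"
    by (rule sums_le[OF _ sums_zero, rotated])
       (intro mult_nonneg_nonneg sum_inner_power_nonneg, simp add: assms)
  then show ?thesis
    by (simp only: split)
qed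

section \<open>Exponential sums over separated points\<close>

text \<open>The two halves of the index range give the same geometric series, bounded by 1 / (1 -
  exp(-a)), and exp(a) \<ge> 1 + a turns this into 1 + 1/a. The bound does not depend on
  \<open>N\<close>.\<close>

lemma sum_exp_floor_le:
  fixes a :: real
  assumes "a > 0"
  shows "(\<Sum>z\<in>{- int N..<int N}. exp (- (a * of_int (if 0 \<le> z then z else - z - 1)))) \<le> 2 * (1 + 1 / a)"
proof -
  let ?e = "\<lambda>z. exp (- (a * of_int (if 0 \<le> z then z else - z - 1)))"
  have geom: "(\<Sum>i<N. exp (- (a * real i))) \<le> 1 + 1 / a"
  proof -
    have lt: "exp (- a) < 1"
      using assms by simp
    have "(\<Sum>i<N. exp (- (a * real i))) = (\<Sum>i<N. exp (- a) ^ i)"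
      by (simp add: exp_of_nat_mult[symmetric] mult.commute)
    also have "\<dots> \<le> (\<Sum>i. exp (- a) ^ i)"
      using lt by (intro sum_le_suminf summable_geometric) auto
    also have "\<dots> = 1 / (1 - exp (- a))"
      using lt by (intro suminf_geometric) auto
    also have "\<dots> \<le> 1 + 1 / a"
    proof -
      have "exp (- a) \<le> 1 / (1 + a)"
        using exp_ge_add_one_self[of a] assms by (simp add: exp_minus field_simps)
      then have "a / (1 + a) \<le> 1 - exp (- a)"
        using assms by (simp add: field_simps)
      then have "1 / (1 - exp (- a)) \<le> 1 / (a / (1 + a))"
        using assms by (intro divide_left_mono) auto
      also have "\<dots> = 1 + 1 / a"
        using assms by (simp add: field_simps)
      finally show ?thesis .
    qed
    finally show ?thesis .
  qed
  have "(\<Sum>z\<in>{0..<int N}. ?e z) = (\<Sum>i<N. exp (- (a * real i)))"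
    by (rule sum.reindex_bij_witness[where i = int and j = nat]) auto
  moreover have "(\<Sum>z\<in>{- int N..<0}. ?e z) = (\<Sum>i<N. exp (- (a * real i)))"
    by (rule sum.reindex_bij_witness[where i = "\<lambda>i. - int i - 1" and j = "\<lambda>z. nat (- z - 1)"]) auto
  moreover have "{- int N..<int N} = {- int N..<0} \<union> {0..<int N}"
    by auto
  ultimately show ?thesis
    using geom by (simp add: sum.union_disjoint)
qed

text \<open>Half-open cubes of side \<open>d / CARD('n)\<close> contain at most one point each, so the sum is
  dominated by a product of one-dimensional geometric series.\<close>

lemma sum_exp_dist_le:
  fixes X :: "'i \<Rightarrow> real ^ 'n"
  assumes d: "d > 0" and sep: "\<And>i j. i \<in> I \<Longrightarrow> j \<in> I \<Longrightarrow> i \<noteq> j \<Longrightarrow> d \<le> norm (X i - X j)"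
    and I: "finite I" and s: "s > 0"
  shows "(\<Sum>j\<in>I. exp (- (s * norm (X j - y)))) \<le>
    (2 * (1 + real CARD('n) ^ 2 / (s * d))) ^ CARD('n)"
proof -
  define n where "n = real CARD('n)"
  have n: "n \<ge> 1" "n > 0"
    unfolding n_def by (auto simp: Suc_le_eq)
  \<comment> \<open>Two points in the same cube of side \<open>h\<close> have l1-distance, hence
    Euclidean distance, less than n h = d.\<close>
  define h where "h = d / n"
  have h: "h > 0"
    using d n by (simp add: h_def)
  define z where "z j = (\<lambda>i. \<lfloor>(X j - y) $ i / h\<rfloor>)" for j
  \<comment> \<open>\<open>g k\<close> is the infimum of |r| over the cell [k, k + 1); for negative
    \<open>k\<close> the end nearest to 0 is k + 1.\<close>
  define g where "g k = (if 0 \<le> k then k else - k - 1)" for k :: int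
  have g_le: "of_int (g \<lfloor>r\<rfloor>) \<le> \<bar>r\<bar>" for r :: real
    unfolding g_def by (auto; linarith)
  have inj: "inj_on z I"
  proof (rule inj_onI, rule ccontr)
    fix j k assume jk: "j \<in> I" "k \<in> I" "z j = z k" "j \<noteq> k"
    have "\<bar>(X j - X k) $ i\<bar> < h" for i
    proof -
      have "\<lfloor>(X j - y) $ i / h\<rfloor> = \<lfloor>(X k - y) $ i / h\<rfloor>"
        using fun_cong[OF jk(3), of i] by (simp add: z_def)
      then have "\<bar>(X j - y) $ i / h - (X k - y) $ i / h\<bar> < 1"
        by linarith
      also have "(X j - y) $ i / h - (X k - y) $ i / h = (X j - X k) $ i / h"
        by (simp add: diff_divide_distrib)
      finally show ?thesis
        using h by (simp add: abs_divide)
    qed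
    then have "(\<Sum>i\<in>UNIV. \<bar>(X j - X k) $ i\<bar>) < (\<Sum>i\<in>(UNIV :: 'n set). h)"
      by (intro sum_strict_mono) auto
    then have "norm (X j - X k) < d"
      using norm_le_l1_cart[of "X j - X k"] n by (simp add: h_def n_def)
    then show False
      using sep[OF jk(1,2,4)] by simp
  qed
  \<comment> \<open>A box large enough to hold the finitely many cube indices; the summand 1 makes
    the upper bound strict, as the half-open range requires.\<close>
  define N where "N = nat (\<Sum>j\<in>I. \<Sum>i\<in>UNIV. \<bar>z j i\<bar>) + 1"
  have z_range: "z j \<in> PiE UNIV (\<lambda>_. {- int N..<int N})" if "j \<in> I" for j
  proof -
    have "\<bar>z j i\<bar> \<le> (\<Sum>j\<in>I. \<Sum>i\<in>UNIV. \<bar>z j i\<bar>)" for i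
    proof -
      have "\<bar>z j i\<bar> \<le> (\<Sum>i\<in>UNIV. \<bar>z j i\<bar>)"
        by (intro member_le_sum) auto
      also have "\<dots> \<le> (\<Sum>j\<in>I. \<Sum>i\<in>UNIV. \<bar>z j i\<bar>)"
        by (rule member_le_sum[OF that]) (auto simp: I intro: sum_nonneg)
      finally show ?thesis .
    qed
    moreover have "int N = (\<Sum>j\<in>I. \<Sum>i\<in>UNIV. \<bar>z j i\<bar>) + 1"
      unfolding N_def by (simp add: sum_nonneg)
    ultimately have "\<bar>z j i\<bar> < int N" for i
      by (metis zle_add1_eq_le)
    then have "- int N \<le> z j i \<and> z j i < int N" for i
      by (metis abs_less_iff less_imp_le minus_less_iff)
    then show ?thesis
      by auto
  qed
  \<comment> \<open>The norm is at least the mean of the absolute values of the coordinates, hence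
    the division by \<open>n\<close>; the factor \<open>h\<close> converts cell indices back to
    lengths.\<close>
  define a where "a = s * h / n"
  have a: "a > 0"
    using s h n by (simp add: a_def)
  have "exp (- (s * norm (X j - y))) \<le> (\<Prod>i\<in>UNIV. exp (- (a * of_int (g (z j i)))))" for j
  proof -
    have "(\<Sum>i\<in>UNIV. a * of_int (g (z j i))) \<le> (\<Sum>i\<in>(UNIV :: 'n set). s * norm (X j - y) / n)"
    proof (intro sum_mono)
      fix i
      have "a * of_int (g (z j i)) \<le> a * \<bar>(X j - y) $ i / h\<bar>"
        unfolding z_def using a by (intro mult_left_mono g_le) auto
      also have "\<dots> = s / n * \<bar>(X j - y) $ i\<bar>"
        using h by (simp add: a_def abs_divide)
      also have "\<dots> \<le> s / n * norm (X j - y)"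
        using s n by (intro mult_left_mono component_le_norm_cart) auto
      finally show "a * of_int (g (z j i)) \<le> s * norm (X j - y) / n"
        by simp
    qed
    also have "\<dots> = s * norm (X j - y)"
      using n by (simp add: n_def)
    finally show ?thesis
      by (simp add: sum_negf flip: exp_sum)
  qed
  then have "(\<Sum>j\<in>I. exp (- (s * norm (X j - y)))) \<le>
      (\<Sum>j\<in>I. (\<lambda>w. \<Prod>i\<in>UNIV. exp (- (a * of_int (g (w i))))) (z j))"
    by (intro sum_mono) auto
  also have "\<dots> = (\<Sum>w\<in>z ` I. \<Prod>i\<in>UNIV. exp (- (a * of_int (g (w i)))))"
    by (simp add: sum.reindex[OF inj])
  also have "\<dots> \<le> (\<Sum>w\<in>PiE UNIV (\<lambda>_. {- int N..<int N}).
      \<Prod>i\<in>(UNIV :: 'n set). exp (- (a * of_int (g (w i)))))"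
    using z_range by (intro sum_mono2 finite_PiE) (auto intro!: prod_nonneg)
  also have "\<dots> = (\<Prod>i\<in>(UNIV :: 'n set). \<Sum>k\<in>{- int N..<int N}. exp (- (a * of_int (g k))))"
    by (rule prod_sum_PiE[symmetric]) auto
  also have "\<dots> \<le> (\<Prod>i\<in>(UNIV :: 'n set). 2 * (1 + 1 / a))"
    using sum_exp_floor_le[OF a, of N] unfolding g_def by (intro prod_mono) (auto intro: sum_nonneg)
  also have "\<dots> = (2 * (1 + n\<^sup>2 / (s * d))) ^ CARD('n)"
    using n by (simp add: a_def h_def power2_eq_square)
  finally show ?thesis
    by (simp add: n_def)
qed

section \<open>Diagonal dominance of Gaussian Gram matrices\<close>

text \<open>The finite Schur test: |u k * u j| is at most half the sum of the two squares, and by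
  symmetry both halves lead to row sums.\<close>

lemma symmetric_form_le:
  fixes w :: "'i \<Rightarrow> 'i \<Rightarrow> real"
  assumes nonneg: "\<And>j k. 0 \<le> w j k" and sym: "\<And>j k. w j k = w k j"
    and row: "\<And>j. j \<in> I \<Longrightarrow> (\<Sum>k\<in>I. w j k) \<le> M"
  shows "\<bar>\<Sum>j\<in>I. \<Sum>k\<in>I. u k * u j * w k j\<bar> \<le> M * (\<Sum>k\<in>I. (u k)\<^sup>2)"
proof -
  have "\<bar>\<Sum>j\<in>I. \<Sum>k\<in>I. u k * u j * w k j\<bar> \<le> (\<Sum>j\<in>I. \<Sum>k\<in>I. \<bar>u k * u j * w k j\<bar>)"
    by (rule order_trans[OF sum_abs]) (intro sum_mono sum_abs)
  also have "\<dots> \<le> (\<Sum>j\<in>I. \<Sum>k\<in>I. (u k)\<^sup>2 / 2 * w k j + (u j)\<^sup>2 / 2 * w j k)"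
  proof (intro sum_mono)
    fix j k
    have "\<bar>u k * u j\<bar> \<le> (u k)\<^sup>2 / 2 + (u j)\<^sup>2 / 2"
      using sum_squares_bound[of "\<bar>u k\<bar>" "\<bar>u j\<bar>"] by (simp add: abs_mult)
    then have "\<bar>u k * u j\<bar> * w k j \<le> ((u k)\<^sup>2 / 2 + (u j)\<^sup>2 / 2) * w k j"
      by (intro mult_right_mono nonneg)
    then show "\<bar>u k * u j * w k j\<bar> \<le> (u k)\<^sup>2 / 2 * w k j + (u j)\<^sup>2 / 2 * w j k"
      using nonneg[of k j] sym[of j k] by (simp add: abs_mult distrib_right)
  qed
  also have "\<dots> = (\<Sum>j\<in>I. \<Sum>k\<in>I. (u k)\<^sup>2 / 2 * w k j) + (\<Sum>j\<in>I. \<Sum>k\<in>I. (u j)\<^sup>2 / 2 * w j k)"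
    by (simp add: sum.distrib)
  also have "(\<Sum>j\<in>I. \<Sum>k\<in>I. (u k)\<^sup>2 / 2 * w k j) = (\<Sum>j\<in>I. \<Sum>k\<in>I. (u j)\<^sup>2 / 2 * w j k)"
    by (rule sum.swap)
  also have "\<dots> + \<dots> = (\<Sum>j\<in>I. (u j)\<^sup>2 * (\<Sum>k\<in>I. w j k))"
    by (simp only: sum_distrib_left flip: sum.distrib) (simp add: field_simps)
  also have "\<dots> \<le> (\<Sum>j\<in>I. (u j)\<^sup>2 * M)"
    by (intro sum_mono mult_left_mono row) auto
  finally show ?thesis
    by (simp add: sum_distrib_left mult.commute)
qed

text \<open>The diagonal contributes the full sum of squares. For large \<open>t\<close> the
  off-diagonal row sums are at most 1/2 on every finite index set, so the off-diagonal part can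
  destroy at most half of it.\<close>

lemma gaussian_form_lower_bound:
  fixes X :: "'i \<Rightarrow> real ^ 'n"
  assumes d: "d > 0" and sep: "\<And>i j. i \<noteq> j \<Longrightarrow> d \<le> norm (X i - X j)"
  shows "\<exists>T>0. \<forall>t\<ge>T. \<forall>I u. finite I \<longrightarrow> (\<Sum>k\<in>I. (u k)\<^sup>2) / 2 \<le>
      (\<Sum>j\<in>I. \<Sum>k\<in>I. u k * u j * exp (- (t * (norm (X k - X j))\<^sup>2)))"
proof -
  define C where "C = (2 * (1 + real CARD('n) ^ 2 / (1 * d))) ^ CARD('n)"
  have C: "C > 0"
    unfolding C_def using d by (intro zero_less_power) (auto intro!: add_pos_nonneg)
  \<comment> \<open>Chosen so that the off-diagonal row sums are at most \<open>exp (- 2 C) C \<le> 1 / 2\<close>.\<close>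
  define T where "T = (1 + 2 * C / d) / d"
  have T: "T > 0"
    unfolding T_def using C d by (auto intro!: divide_pos_pos add_pos_pos)
  show ?thesis
  proof (intro exI[of _ T] conjI allI impI T)
    fix t and I :: "'i set" and u :: "'i \<Rightarrow> real"
    assume t: "t \<ge> T" and I: "finite I"
    define w where "w j k = (if j = k then 0 else exp (- (t * (norm (X j - X k))\<^sup>2)))" for j k
    \<comment> \<open>For r \<ge> d the exponent satisfies t r^2 \<ge> t d r \<ge> 2 C + r. The part
      2 C makes the row sum small, while the part r keeps it summable over the separated
      points.\<close>
    have w_le: "w k j \<le> exp (- (2 * C)) * exp (- (1 * norm (X j - X k)))" for k j
    proof (cases "j = k")
      case False
      define r where "r = norm (X j - X k)"
      have r: "r \<ge> d"
        using sep[OF False] by (simp add: r_def)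
      have *: "2 * C / d \<le> t * d - 1"
        using t d pos_divide_le_eq[of d "1 + 2 * C / d" t] by (simp add: T_def)
      have "0 \<le> 2 * C / d"
        using C d by simp
      with * have td: "t * d - 1 \<ge> 0"
        by linarith
      from * have "2 * C \<le> (t * d - 1) * d"
        using d by (metis pos_divide_le_eq)
      also have "\<dots> \<le> (t * d - 1) * r"
        using r td by (intro mult_left_mono)
      finally have "2 * C + r \<le> t * d * r"
        by (simp add: algebra_simps)
      also have "\<dots> \<le> t * r * r"
        using r d t T by (intro mult_right_mono mult_left_mono) auto
      finally show ?thesis
        using False by (simp add: w_def r_def power2_eq_square norm_minus_commute mult.assoc flip: exp_add)
    qed (simp add: w_def)
    have row: "(\<Sum>j\<in>I. w k j) \<le> 1 / 2" for k
    proof -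
      have "(\<Sum>j\<in>I. w k j) \<le> (\<Sum>j\<in>I. exp (- (2 * C)) * exp (- (1 * norm (X j - X k))))"
        by (intro sum_mono w_le)
      also have "\<dots> \<le> exp (- (2 * C)) * C"
        unfolding sum_distrib_left[symmetric] C_def
        by (intro mult_left_mono sum_exp_dist_le d I sep) auto
      also have "\<dots> \<le> 1 / 2"
      proof -
        have "2 * C \<le> exp (2 * C)"
          using exp_ge_add_one_self[of "2 * C"] by linarith
        then have "exp (- (2 * C)) * (2 * C) \<le> exp (- (2 * C)) * exp (2 * C)"
          by (intro mult_left_mono) auto
        then show ?thesis
          by (simp flip: exp_add)
      qed
      finally show ?thesis .
    qed
    have "(\<Sum>j\<in>I. \<Sum>k\<in>I. u k * u j * exp (- (t * (norm (X k - X j))\<^sup>2))) =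
        (\<Sum>j\<in>I. \<Sum>k\<in>I. (if k = j then (u k)\<^sup>2 else 0) + u k * u j * w k j)"
      by (intro sum.cong) (auto simp: w_def power2_eq_square)
    also have "\<dots> = (\<Sum>k\<in>I. (u k)\<^sup>2) + (\<Sum>j\<in>I. \<Sum>k\<in>I. u k * u j * w k j)"
      using I by (simp add: sum.distrib)
    finally have eq: "(\<Sum>j\<in>I. \<Sum>k\<in>I. u k * u j * exp (- (t * (norm (X k - X j))\<^sup>2))) =
        (\<Sum>k\<in>I. (u k)\<^sup>2) + (\<Sum>j\<in>I. \<Sum>k\<in>I. u k * u j * w k j)" .
    have "\<bar>\<Sum>j\<in>I. \<Sum>k\<in>I. u k * u j * w k j\<bar> \<le> 1 / 2 * (\<Sum>k\<in>I. (u k)\<^sup>2)"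
      using row by (intro symmetric_form_le) (auto simp: w_def norm_minus_commute)
    then show "(\<Sum>k\<in>I. (u k)\<^sup>2) / 2 \<le>
        (\<Sum>j\<in>I. \<Sum>k\<in>I. u k * u j * exp (- (t * (norm (X k - X j))\<^sup>2)))"
      unfolding eq by linarith
  qed
qed

section \<open>Exponential kernels\<close>

text \<open>Since (v + a/v)^2 and (v - a/v)^2 differ from v^2 + a^2/v^2 only by the constants 2 a
  and -2 a, the integrand has an antiderivative built from the Gaussian distribution function. The
  case a = 0 is separate because v - a/v then no longer tends to minus infinity at 0.\<close>

lemma has_bochner_integral_gaussian_subordination:
  fixes a :: real
  assumes "a \<ge> 0"
  shows "has_bochner_integral lborel
    (\<lambda>v. indicator {0<..} v * exp (- (v\<^sup>2 + a\<^sup>2 / v\<^sup>2))) (sqrt pi / 2 * exp (- (2 * a)))"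
proof (cases "a = 0")
  case True
  have "has_bochner_integral lborel (\<lambda>v::real. indicator {0..} v *\<^sub>R exp (- v\<^sup>2)) (sqrt pi / 2)"
    by (rule gaussian_moment_0)
  also have "?this \<longleftrightarrow> has_bochner_integral lborel
      (\<lambda>v. indicator {0<..} v * exp (- (v\<^sup>2 + a\<^sup>2 / v\<^sup>2))) (sqrt pi / 2)"
    by (rule has_bochner_integral_cong_AE)
       (auto simp: True intro!: AE_I[where N = "{0}"] split: split_indicator)
  finally show ?thesis
    by (simp add: True)
next
  case False
  with assms have "a > 0"
    by simp
  \<comment> \<open>The standard deviation 1 / sqrt 2 yields the density exp(-x^2) / sqrt pi, so
    \<open>G\<close> is (1 + erf) / 2.\<close>
  define g where "g = normal_density 0 (1 / sqrt 2)"
  define M where "M = density lborel g"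
  define G where "G = cdf M"
  \<comment> \<open>An antiderivative of the integrand \<open>h\<close>.\<close>
  define F where "F v = sqrt pi / 2 *
    (exp (2 * a) * G (v + a / v) + exp (- (2 * a)) * G (v - a / v))" for v
  define h where "h v = exp (- (v\<^sup>2 + a\<^sup>2 / v\<^sup>2))" for v
  interpret M: real_distribution M
    unfolding M_def g_def
    by (intro real_distribution.intro real_distribution_axioms.intro prob_space_normal_density) auto
  have g: "g x = exp (- x\<^sup>2) / sqrt pi" for x
    by (simp add: g_def normal_density_def power_divide)
  have cont_g: "continuous_on A g" for A
    unfolding g[abs_def] by (intro continuous_intros) auto
  have G_diff: "G y - G b = integral {b..y} g" if "b \<le> y" for b y
  proof -
    have "G y - G b = measure M {b<..y}" if "b < y"
      using that unfolding G_def by (rule M.cdf_diff_eq)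
    then have "G y - G b = measure M {b<..y}"
      using \<open>b \<le> y\<close> by (cases "b = y") auto
    also have "\<dots> = (\<integral>x. indicator {b<..y} x \<partial>M)"
      by simp
    also have "\<dots> = (\<integral>x. g x * indicator {b<..y} x \<partial>lborel)"
      unfolding M_def by (subst integral_density) (auto simp: g_def)
    also have "\<dots> = set_lebesgue_integral lborel {b<..y} g"
      by (simp add: set_lebesgue_integral_def mult.commute)
    also have "\<dots> = set_lebesgue_integral lborel {b..y} g"
      by (rule set_integral_cong_set)
         (auto simp: set_borel_measurable_def g_def intro!: AE_I[where N = "{b}"])
    also have "\<dots> = integral {b..y} g"
      by (rule set_borel_integral_eq_integral, rule borel_integrable_atLeastAtMost', rule cont_g)
    finally show ?thesis .
  qed
  have G_deriv: "(G has_real_derivative g y) (at y)" for y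
  proof -
    have "((\<lambda>u. integral {y - 1..u} g) has_real_derivative g y) (at y within {y - 1..y + 1})"
      by (rule integral_has_real_derivative[OF cont_g]) auto
    then have "((\<lambda>u. integral {y - 1..u} g) has_real_derivative g y) (at y)"
      by (simp add: at_within_Icc_at)
    then have "((\<lambda>u. G (y - 1) + integral {y - 1..u} g) has_real_derivative g y) (at y)"
      by (auto intro!: derivative_eq_intros)
    then show ?thesis
    proof (rule has_field_derivative_transform_within[where d = 1])
      show "G (y - 1) + integral {y - 1..u} g = G u" if "dist u y < 1" for u
        using G_diff[of "y - 1" u] that by (simp add: dist_real_def abs_less_iff)
    qed auto
  qed
  have F_deriv: "(F has_real_derivative h v) (at v)" if "v > 0" for v
  proof -
    \<comment> \<open>The prefactor cancels the cross term of the square, so both Gaussian terms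
      reduce to the same multiple of \<open>h v\<close>; the contributions of a / v^2 then cancel in
      the derivative of \<open>F\<close>.\<close>
    have 1: "exp (2 * a) * g (v + a / v) = h v / sqrt pi"
    proof -
      have "2 * a + - (v + a / v)\<^sup>2 = - (v\<^sup>2 + a\<^sup>2 / v\<^sup>2)"
        using that by (simp add: power2_sum power_divide)
      then show ?thesis
        by (simp add: g h_def flip: exp_add)
    qed
    have 2: "exp (- (2 * a)) * g (v - a / v) = h v / sqrt pi"
    proof -
      have "- (2 * a) + - (v - a / v)\<^sup>2 = - (v\<^sup>2 + a\<^sup>2 / v\<^sup>2)"
        using that by (simp add: power2_diff power_divide)
      then show ?thesis
        by (simp add: g h_def flip: exp_add)
    qed
    have "(F has_real_derivative sqrt pi / 2 *
        ((exp (2 * a) * g (v + a / v)) * (1 - a / v\<^sup>2) +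
         (exp (- (2 * a)) * g (v - a / v)) * (1 + a / v\<^sup>2))) (at v)"
      unfolding F_def using that
      by (auto intro!: derivative_eq_intros DERIV_chain2[OF G_deriv]
          simp: power2_eq_square field_simps)
    then show ?thesis
      unfolding 1 2 by (rule back_subst[where P = "\<lambda>D. (F has_real_derivative D) (at v)"])
        (simp add: algebra_simps)
  qed
  have top: "(G \<longlongrightarrow> 1) at_top" and bot: "(G \<longlongrightarrow> 0) at_bot"
    unfolding G_def by (rule M.cdf_lim_at_top_prob, rule M.cdf_lim_at_bot)
  \<comment> \<open>At 0 the arguments of \<open>G\<close> go to plus and minus infinity, so only
    the first term survives. It also occurs in the limit at infinity, and the difference leaves
    exp(-2 a).\<close>
  have lim0: "(F \<longlongrightarrow> sqrt pi / 2 * (exp (2 * a) * 1 + exp (- (2 * a)) * 0)) (at_right 0)"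
    unfolding F_def
  proof (intro tendsto_intros)
    show "((\<lambda>v. G (v + a / v)) \<longlongrightarrow> 1) (at_right 0)"
      by (rule filterlim_compose[OF top]) (use \<open>a > 0\<close> in real_asymp)
    show "((\<lambda>v. G (v - a / v)) \<longlongrightarrow> 0) (at_right 0)"
      by (rule filterlim_compose[OF bot]) (use \<open>a > 0\<close> in real_asymp)
  qed
  have lim1: "(F \<longlongrightarrow> sqrt pi / 2 * (exp (2 * a) * 1 + exp (- (2 * a)) * 1)) at_top"
    unfolding F_def
  proof (intro tendsto_intros)
    show "((\<lambda>v. G (v + a / v)) \<longlongrightarrow> 1) at_top"
      by (rule filterlim_compose[OF top]) (use \<open>a > 0\<close> in real_asymp)
    show "((\<lambda>v. G (v - a / v)) \<longlongrightarrow> 1) at_top"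
      by (rule filterlim_compose[OF top]) (use \<open>a > 0\<close> in real_asymp)
  qed
  have FTC: "set_integrable lborel (einterval 0 \<infinity>) h"
    "(LBINT v=0..\<infinity>. h v) = sqrt pi / 2 * (exp (2 * a) * 1 + exp (- (2 * a)) * 1) -
      sqrt pi / 2 * (exp (2 * a) * 1 + exp (- (2 * a)) * 0)"
  proof -
    have "((F \<circ> real_of_ereal) \<longlongrightarrow> sqrt pi / 2 * (exp (2 * a) * 1 + exp (- (2 * a)) * 0)) (at_right 0)"
      using lim0 by (simp add: zero_ereal_def ereal_tendsto_simps del: zero_ereal_def[symmetric])
    moreover have "((F \<circ> real_of_ereal) \<longlongrightarrow> sqrt pi / 2 * (exp (2 * a) * 1 + exp (- (2 * a)) * 1)) (at_left \<infinity>)"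
      using lim1 by (simp add: ereal_tendsto_simps)
    moreover have "isCont h v" if "0 < ereal v" for v
      using that unfolding h_def by (intro continuous_intros) auto
    ultimately show "set_integrable lborel (einterval 0 \<infinity>) h"
      "(LBINT v=0..\<infinity>. h v) = sqrt pi / 2 * (exp (2 * a) * 1 + exp (- (2 * a)) * 1) -
        sqrt pi / 2 * (exp (2 * a) * 1 + exp (- (2 * a)) * 0)"
      using F_deriv by (intro interval_integral_FTC_nonneg[where F = F]; simp add: h_def)+
  qed
  have "einterval 0 \<infinity> = {0::real<..}"
    by (auto simp: einterval_def)
  with FTC show ?thesis
    by (simp add: has_bochner_integral_iff set_integrable_def set_lebesgue_integral_def h_def
        interval_lebesgue_integral_def algebra_simps)
qed

text \<open>Taking a = s |x| / 2 in the Gaussian integral represents the exponential form as a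
  mixture of Gaussian forms with parameter t = s^2 / (4 v^2) and weight exp(-v^2).\<close>

lemma has_bochner_integral_exp_norm_form:
  fixes x :: "'i \<Rightarrow> 'a::euclidean_space"
  assumes "s \<ge> 0"
  shows "has_bochner_integral lborel
    (\<lambda>v. indicator {0<..} v * (exp (- v\<^sup>2) *
      (\<Sum>j\<in>I. \<Sum>k\<in>I. u k * u j * exp (- (s\<^sup>2 / (4 * v\<^sup>2) * (norm (x k - x j))\<^sup>2)))))
    (sqrt pi / 2 * (\<Sum>j\<in>I. \<Sum>k\<in>I. u k * u j * exp (- (s * norm (x k - x j)))))"
proof -
  have *: "has_bochner_integral lborel
      (\<lambda>v. u k * u j * (indicator {0<..} v * exp (- (v\<^sup>2 + (s * norm (x k - x j) / 2)\<^sup>2 / v\<^sup>2))))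
      (u k * u j * (sqrt pi / 2 * exp (- (2 * (s * norm (x k - x j) / 2)))))" for j k
    using assms
    by (intro has_bochner_integral_mult_right has_bochner_integral_gaussian_subordination) simp
  have "has_bochner_integral lborel
      (\<lambda>v. \<Sum>j\<in>I. \<Sum>k\<in>I. u k * u j *
        (indicator {0<..} v * exp (- (v\<^sup>2 + (s * norm (x k - x j) / 2)\<^sup>2 / v\<^sup>2))))
      (\<Sum>j\<in>I. \<Sum>k\<in>I. u k * u j * (sqrt pi / 2 * exp (- (2 * (s * norm (x k - x j) / 2)))))"
    by (intro has_bochner_integral_sum *)
  also have "(\<lambda>v. \<Sum>j\<in>I. \<Sum>k\<in>I. u k * u j *
        (indicator {0<..} v * exp (- (v\<^sup>2 + (s * norm (x k - x j) / 2)\<^sup>2 / v\<^sup>2)))) =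
      (\<lambda>v. indicator {0<..} v * (exp (- v\<^sup>2) *
        (\<Sum>j\<in>I. \<Sum>k\<in>I. u k * u j * exp (- (s\<^sup>2 / (4 * v\<^sup>2) * (norm (x k - x j))\<^sup>2)))))"
  proof -
    have "u k * u j * (indicator {0<..} v * exp (- (v\<^sup>2 + (s * norm (x k - x j) / 2)\<^sup>2 / v\<^sup>2))) =
        indicator {0<..} v * (exp (- v\<^sup>2) *
          (u k * u j * exp (- (s\<^sup>2 / (4 * v\<^sup>2) * (norm (x k - x j))\<^sup>2))))" for v k j
    proof -
      have "- (v\<^sup>2 + (s * norm (x k - x j) / 2)\<^sup>2 / v\<^sup>2) =
          - v\<^sup>2 + - (s\<^sup>2 / (4 * v\<^sup>2) * (norm (x k - x j))\<^sup>2)"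
        by (simp add: power_mult_distrib power_divide)
      then show ?thesis
        by (simp only: exp_add mult_ac)
    qed
    then show ?thesis
      by (simp only: sum_distrib_left)
  qed
  also have "(\<Sum>j\<in>I. \<Sum>k\<in>I. u k * u j * (sqrt pi / 2 * exp (- (2 * (s * norm (x k - x j) / 2))))) =
      sqrt pi / 2 * (\<Sum>j\<in>I. \<Sum>k\<in>I. u k * u j * exp (- (s * norm (x k - x j))))"
    by (simp add: sum_distrib_left mult_ac)
  finally show ?thesis .
qed

lemma exp_norm_form_nonneg:
  fixes x :: "'i \<Rightarrow> 'a::euclidean_space"
  assumes "s \<ge> 0"
  shows "0 \<le> (\<Sum>j\<in>I. \<Sum>k\<in>I. u k * u j * exp (- (s * norm (x k - x j))))"
proof -
  have "0 \<le> sqrt pi / 2 * (\<Sum>j\<in>I. \<Sum>k\<in>I. u k * u j * exp (- (s * norm (x k - x j))))"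
    unfolding has_bochner_integral_integral_eq[OF has_bochner_integral_exp_norm_form[OF assms], symmetric]
    by (intro Bochner_Integration.integral_nonneg mult_nonneg_nonneg gaussian_form_nonneg) auto
  then show ?thesis
    by (simp add: zero_le_mult_iff) (use pi_gt_zero in linarith)
qed

text \<open>Only the range 0 < v \<le> b of the mixture is kept, where the Gaussian parameter is at
  least \<open>T\<close> for every s \<ge> s0. The rest of the integral is nonnegative by positive
  definiteness.\<close>

lemma exp_norm_form_lower_bound:
  fixes X :: "'i \<Rightarrow> real ^ 'n"
  assumes d: "d > 0" and sep: "\<And>i j. i \<noteq> j \<Longrightarrow> d \<le> norm (X i - X j)" and s0: "s0 > 0"
  shows "\<exists>c>0. \<forall>s\<ge>s0. \<forall>I u. finite I \<longrightarrow> c * (\<Sum>k\<in>I. (u k)\<^sup>2) \<le>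
      (\<Sum>j\<in>I. \<Sum>k\<in>I. u k * u j * exp (- (s * norm (X k - X j))))"
proof -
  have "\<exists>T>0. \<forall>t\<ge>T. \<forall>I u. finite I \<longrightarrow> (\<Sum>k\<in>I. (u k)\<^sup>2) / 2 \<le>
      (\<Sum>j\<in>I. \<Sum>k\<in>I. u k * u j * exp (- (t * (norm (X k - X j))\<^sup>2)))"
    by (rule gaussian_form_lower_bound[OF d sep])
  then obtain T where T: "T > 0" "\<forall>t\<ge>T. \<forall>I u. finite I \<longrightarrow> (\<Sum>k\<in>I. (u k)\<^sup>2) / 2 \<le>
      (\<Sum>j\<in>I. \<Sum>k\<in>I. u k * u j * exp (- (t * (norm (X k - X j))\<^sup>2)))"
    by (elim exE conjE) (rule that)
  \<comment> \<open>\<open>b\<close> solves s0^2 / (4 b^2) = T.\<close>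
  define b where "b = s0 / (2 * sqrt T)"
  have b: "b > 0"
    using s0 T by (simp add: b_def)
  show ?thesis
  \<comment> \<open>The interval length \<open>b\<close>, the minimum exp(-b^2) of the weight and
    the Gaussian constant 1/2, divided by the normalising factor sqrt pi / 2.\<close>
  proof (intro exI[of _ "b * exp (- b\<^sup>2) / sqrt pi"] conjI allI impI)
    show "b * exp (- b\<^sup>2) / sqrt pi > 0"
      using b by simp
    fix s and I :: "'i set" and u :: "'i \<Rightarrow> real"
    assume s: "s \<ge> s0" and I: "finite I"
    let ?Q = "\<lambda>t. \<Sum>j\<in>I. \<Sum>k\<in>I. u k * u j * exp (- (t * (norm (X k - X j))\<^sup>2))"
    let ?U = "\<Sum>k\<in>I. (u k)\<^sup>2"
    have "has_bochner_integral lborel (\<lambda>v. indicator {0<..b} v * (exp (- b\<^sup>2) * (?U / 2)))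
        (b * (exp (- b\<^sup>2) * (?U / 2)))"
      using has_bochner_integral_real_indicator[of "{0<..b}" lborel] b
      by (intro has_bochner_integral_mult_left) simp
    moreover have "has_bochner_integral lborel
        (\<lambda>v. indicator {0<..} v * (exp (- v\<^sup>2) * ?Q (s\<^sup>2 / (4 * v\<^sup>2))))
        (sqrt pi / 2 * (\<Sum>j\<in>I. \<Sum>k\<in>I. u k * u j * exp (- (s * norm (X k - X j)))))"
      using s s0 by (intro has_bochner_integral_exp_norm_form) simp
    moreover have "indicator {0<..b} v * (exp (- b\<^sup>2) * (?U / 2)) \<le>
        indicator {0<..} v * (exp (- v\<^sup>2) * ?Q (s\<^sup>2 / (4 * v\<^sup>2)))" for v
    proof (cases "v \<in> {0<..b}")
      case True
      have "v\<^sup>2 \<le> b\<^sup>2"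
        using True by (intro power_mono) auto
      have "T = s0\<^sup>2 / (4 * b\<^sup>2)"
        using s0 T by (simp add: b_def power_divide power_mult_distrib)
      also have "\<dots> \<le> s\<^sup>2 / (4 * v\<^sup>2)"
        using True s s0 \<open>v\<^sup>2 \<le> b\<^sup>2\<close> by (intro frac_le power_mono) auto
      finally have "?U / 2 \<le> ?Q (s\<^sup>2 / (4 * v\<^sup>2))"
        by (intro T(2)[rule_format] I)
      then have "exp (- b\<^sup>2) * (?U / 2) \<le> exp (- v\<^sup>2) * ?Q (s\<^sup>2 / (4 * v\<^sup>2))"
        using \<open>v\<^sup>2 \<le> b\<^sup>2\<close> by (intro mult_mono) (auto intro: sum_nonneg)
      then show ?thesis
        using True by simp
    next
      case False
      have "0 \<le> indicator {0<..} v * (exp (- v\<^sup>2) * ?Q (s\<^sup>2 / (4 * v\<^sup>2)))"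
        by (intro mult_nonneg_nonneg gaussian_form_nonneg) auto
      then show ?thesis
        using False by simp
    qed
    ultimately have "b * (exp (- b\<^sup>2) * (?U / 2)) \<le>
        sqrt pi / 2 * (\<Sum>j\<in>I. \<Sum>k\<in>I. u k * u j * exp (- (s * norm (X k - X j))))"
      by (metis (no_types, lifting) has_bochner_integral_iff integral_mono)
    then show "b * exp (- b\<^sup>2) / sqrt pi * ?U \<le>
        (\<Sum>j\<in>I. \<Sum>k\<in>I. u k * u j * exp (- (s * norm (X k - X j))))"
      by (simp add: field_simps)
  qed
qed

section \<open>Hermitian forms and separation\<close>

text \<open>For a real symmetric kernel the mixed terms in real and imaginary parts cancel, which
  reduces complex coefficients to two real forms.\<close>

lemma hermitian_form_eq:
  fixes w :: "'i \<Rightarrow> 'i \<Rightarrow> real" and \<xi> :: "'i \<Rightarrow> complex"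
  assumes sym: "\<And>j k. w j k = w k j"
  shows "(\<Sum>j\<in>I. \<Sum>k\<in>I. \<xi> k * cnj (\<xi> j) * complex_of_real (w k j)) =
    complex_of_real ((\<Sum>j\<in>I. \<Sum>k\<in>I. Re (\<xi> k) * Re (\<xi> j) * w k j) +
      (\<Sum>j\<in>I. \<Sum>k\<in>I. Im (\<xi> k) * Im (\<xi> j) * w k j))"
proof (rule complex_eqI)
  have "(\<Sum>j\<in>I. \<Sum>k\<in>I. Im (\<xi> k) * Re (\<xi> j) * w k j) =
      (\<Sum>j\<in>I. \<Sum>k\<in>I. Re (\<xi> k) * Im (\<xi> j) * w k j)"
    by (subst sum.swap) (simp add: sym mult_ac)
  then show "Im (\<Sum>j\<in>I. \<Sum>k\<in>I. \<xi> k * cnj (\<xi> j) * complex_of_real (w k j)) =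
      Im (complex_of_real ((\<Sum>j\<in>I. \<Sum>k\<in>I. Re (\<xi> k) * Re (\<xi> j) * w k j) +
        (\<Sum>j\<in>I. \<Sum>k\<in>I. Im (\<xi> k) * Im (\<xi> j) * w k j)))"
    by (simp add: algebra_simps sum_subtractf)
  show "Re (\<Sum>j\<in>I. \<Sum>k\<in>I. \<xi> k * cnj (\<xi> j) * complex_of_real (w k j)) =
      Re (complex_of_real ((\<Sum>j\<in>I. \<Sum>k\<in>I. Re (\<xi> k) * Re (\<xi> j) * w k j) +
        (\<Sum>j\<in>I. \<Sum>k\<in>I. Im (\<xi> k) * Im (\<xi> j) * w k j)))"
    by (simp add: distrib_right sum.distrib)
qed

lemma separation_le:
  assumes "i \<noteq> j"
  shows "separation X \<le> norm (X i - X j)"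
  unfolding separation_def
proof (rule cInf_lower)
  show "norm (X i - X j) \<in> {norm (X k - X j) | k j. k \<noteq> j}"
    using assms by blast
  show "bdd_below {norm (X k - X j) | k j. k \<noteq> j}"
    by (rule bdd_belowI[of _ 0]) auto
qed

lemma separation_zeroE:
  assumes "\<not> separation X > 0" "e > 0"
  obtains i j where "i \<noteq> j" "norm (X i - X j) < e"
proof -
  have "Inf {norm (X k - X j) | k j. k \<noteq> j} < e"
    using assms unfolding separation_def by linarith
  moreover have "norm (X 0 - X 1) \<in> {norm (X k - X j) | k j. k \<noteq> j}"
    using zero_neq_one by blast
  ultimately obtain r where "r \<in> {norm (X k - X j) | k j. k \<noteq> j}" "r < e"
    using cInf_lessD by (metis (no_types, lifting) empty_iff)
  then show ?thesis
    using that by auto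
qed

section \<open>Functions of the form \<open>f |x|\<close>\<close>

text \<open>The measure is carried by the half-line itself, so integrals against it run over s \<ge>
  0 without an indicator.\<close>

locale laplace_representation = finite_measure \<tau> for \<tau> :: "real measure" +
  fixes f :: "real \<Rightarrow> real"
  assumes sets_tau: "sets \<tau> = sets (restrict_space borel {0..})"
    and f_eq: "\<And>t. t \<ge> 0 \<Longrightarrow> f t = (\<integral>s. exp (- (t * s)) \<partial>\<tau>)"
begin

lemma space_tau: "space \<tau> = {0..}"
  using sets_eq_imp_space_eq[OF sets_tau] by (simp add: space_restrict_space)

lemma borel_measurable_tau: "g \<in> measurable borel N \<Longrightarrow> g \<in> measurable \<tau> N"
  by (simp add: measurable_cong_sets[OF sets_tau refl] measurable_restrict_space1)

lemma sets_tau_atLeast: "s \<ge> 0 \<Longrightarrow> {s..} \<in> sets \<tau>"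
  by (simp add: sets_tau sets_restrict_space_iff)

lemma integrable_exp:
  assumes "t \<ge> 0"
  shows "integrable \<tau> (\<lambda>s. exp (- (t * s)))"
proof (rule integrable_const_bound[where B = 1])
  show "AE s in \<tau>. norm (exp (- (t * s))) \<le> 1"
    using assms by (auto simp: space_tau)
qed (intro borel_measurable_tau, simp)

lemma integrable_norm_form:
  fixes x :: "'i \<Rightarrow> 'a::real_normed_vector"
  shows "integrable \<tau> (\<lambda>s. \<Sum>j\<in>I. \<Sum>k\<in>I. u k * u j * exp (- (s * norm (x k - x j))))"
proof -
  have "integrable \<tau> (\<lambda>s. exp (- (s * norm (x k - x j))))" for j k
    using integrable_exp[of "norm (x k - x j)"] by (simp add: mult.commute)
  then show ?thesis
    by (intro Bochner_Integration.integrable_sum integrable_mult_right)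
qed

text \<open>Transfers estimates on exponential kernels to \<open>f\<close>: the integral passes
  through the finite sums.\<close>

lemma norm_form_eq:
  fixes x :: "'i \<Rightarrow> 'a::real_normed_vector"
  shows "(\<Sum>j\<in>I. \<Sum>k\<in>I. u k * u j * f (norm (x k - x j))) =
    (\<integral>s. (\<Sum>j\<in>I. \<Sum>k\<in>I. u k * u j * exp (- (s * norm (x k - x j)))) \<partial>\<tau>)"
proof -
  have "integrable \<tau> (\<lambda>s. exp (- (s * norm (x k - x j))))" for j k
    using integrable_exp[of "norm (x k - x j)"] by (simp add: mult.commute)
  moreover have "f (norm (x k - x j)) = (\<integral>s. exp (- (s * norm (x k - x j))) \<partial>\<tau>)" for j k
    by (subst f_eq) (simp_all add: mult.commute)
  ultimately show ?thesis
    by (simp add: Bochner_Integration.integral_sum Bochner_Integration.integrable_sum)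
qed

lemma norm_form_nonneg:
  fixes x :: "'i \<Rightarrow> 'a::euclidean_space"
  shows "0 \<le> (\<Sum>j\<in>I. \<Sum>k\<in>I. u k * u j * f (norm (x k - x j)))"
  unfolding norm_form_eq
proof (rule Bochner_Integration.integral_nonneg_AE, rule AE_I2)
  fix s assume "s \<in> space \<tau>"
  then show "0 \<le> (\<Sum>j\<in>I. \<Sum>k\<in>I. u k * u j * exp (- (s * norm (x k - x j))))"
    by (intro exp_norm_form_nonneg) (simp add: space_tau)
qed

text \<open>If all tails [1/n, \<infinity>) were null, the measure would be concentrated at 0 and
  its Laplace transform would be constant.\<close>

lemma ex_positive_tail:
  assumes "\<not> f constant_on {0..}"
  shows "\<exists>s0>0. measure \<tau> {s0..} > 0"
proof (rule ccontr)
  assume "\<not> ?thesis"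
  then have "measure \<tau> {1 / real (Suc n)..} = 0" for n
    using measure_nonneg[of \<tau> "{1 / real (Suc n)..}"] zero_less_divide_1_iff of_nat_0_less_iff
    by (metis less_eq_real_def zero_less_Suc)
  then have "{1 / real (Suc n)..} \<in> null_sets \<tau>" for n
    using sets_tau_atLeast[of "1 / real (Suc n)"] by (auto simp: null_sets_def emeasure_eq_measure)
  then have "(\<Union>n. {1 / real (Suc n)..}) \<in> null_sets \<tau>"
    by (intro null_sets_UN)
  moreover have "{s \<in> space \<tau>. s \<noteq> 0} \<subseteq> (\<Union>n. {1 / real (Suc n)..})"
  proof
    fix s assume "s \<in> {s \<in> space \<tau>. s \<noteq> 0}"
    then have "s > 0"
      by (auto simp: space_tau)
    then obtain n where "1 / real (Suc n) < s"
      using nat_approx_posE by blast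
    then show "s \<in> (\<Union>n. {1 / real (Suc n)..})"
      by (auto intro!: exI[of _ n])
  qed
  ultimately have "AE s in \<tau>. s = 0"
    by (intro AE_I') auto
  then have "(\<integral>s. exp (- (t * s)) \<partial>\<tau>) = (\<integral>s. 1 \<partial>\<tau>)" for t
    by (intro integral_cong_AE borel_measurable_tau) auto
  then have "f constant_on {0..}"
    by (auto simp: constant_on_def f_eq)
  with assms show False
    by simp
qed

text \<open>The exponential forms are bounded below uniformly on a tail s \<ge> s0 of positive
  measure and are nonnegative elsewhere; integration multiplies the constant by the mass of the
  tail.\<close>

lemma norm_form_lower_bound:
  fixes X :: "'i \<Rightarrow> real ^ 'n"
  assumes nonconst: "\<not> f constant_on {0..}"
    and d: "d > 0" and sep: "\<And>i j. i \<noteq> j \<Longrightarrow> d \<le> norm (X i - X j)"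
  shows "\<exists>c>0. \<forall>I u. finite I \<longrightarrow> c * (\<Sum>k\<in>I. (u k)\<^sup>2) \<le>
    (\<Sum>j\<in>I. \<Sum>k\<in>I. u k * u j * f (norm (X k - X j)))"
proof -
  obtain s0 where s0: "s0 > 0" "measure \<tau> {s0..} > 0"
    using ex_positive_tail[OF nonconst] by blast
  have "\<exists>c>0. \<forall>s\<ge>s0. \<forall>I u. finite I \<longrightarrow> c * (\<Sum>k\<in>I. (u k)\<^sup>2) \<le>
      (\<Sum>j\<in>I. \<Sum>k\<in>I. u k * u j * exp (- (s * norm (X k - X j))))"
    by (rule exp_norm_form_lower_bound[OF d sep s0(1)])
  then obtain c where c: "c > 0" "\<forall>s\<ge>s0. \<forall>I u. finite I \<longrightarrow> c * (\<Sum>k\<in>I. (u k)\<^sup>2) \<le>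
      (\<Sum>j\<in>I. \<Sum>k\<in>I. u k * u j * exp (- (s * norm (X k - X j))))"
    by (elim exE conjE) (rule that)
  show ?thesis
  proof (intro exI[of _ "c * measure \<tau> {s0..}"] conjI allI impI)
    show "c * measure \<tau> {s0..} > 0"
      using c s0 by simp
    fix I :: "'i set" and u :: "'i \<Rightarrow> real"
    assume I: "finite I"
    let ?U = "\<Sum>k\<in>I. (u k)\<^sup>2"
    have "c * measure \<tau> {s0..} * ?U = (\<integral>s. indicator {s0..} s * (c * ?U) \<partial>\<tau>)"
      using s0 sets_tau_atLeast[of s0] by (simp add: space_tau Int_absorb2)
    also have "\<dots> \<le> (\<integral>s. (\<Sum>j\<in>I. \<Sum>k\<in>I. u k * u j * exp (- (s * norm (X k - X j)))) \<partial>\<tau>)"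
    proof (intro integral_mono integrable_norm_form)
      show "integrable \<tau> (\<lambda>s. indicator {s0..} s * (c * ?U))"
        using s0 sets_tau_atLeast[of s0]
        by (intro integrable_mult_left integrable_real_indicator) (auto simp: emeasure_eq_measure)
      fix s assume s: "s \<in> space \<tau>"
      have "s \<ge> s0 \<Longrightarrow> c * ?U \<le> (\<Sum>j\<in>I. \<Sum>k\<in>I. u k * u j * exp (- (s * norm (X k - X j))))"
        by (intro c(2)[rule_format] I)
      moreover have "0 \<le> (\<Sum>j\<in>I. \<Sum>k\<in>I. u k * u j * exp (- (s * norm (X k - X j))))"
        using s by (intro exp_norm_form_nonneg) (simp add: space_tau)
      ultimately show "indicator {s0..} s * (c * ?U) \<le>
          (\<Sum>j\<in>I. \<Sum>k\<in>I. u k * u j * exp (- (s * norm (X k - X j))))"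
        by (simp split: split_indicator)
    qed
    finally show "c * measure \<tau> {s0..} * ?U \<le>
        (\<Sum>j\<in>I. \<Sum>k\<in>I. u k * u j * f (norm (X k - X j)))"
      by (simp only: norm_form_eq)
  qed
qed

lemma positive_definite_norm:
  assumes "continuous_on {0..} f"
  shows "positive_definite (\<lambda>x :: real ^ 'n. complex_of_real (f (norm x)))"
  unfolding positive_definite_def
proof (intro conjI allI)
  have "continuous_on UNIV (\<lambda>x :: real ^ 'n. complex_of_real (f (norm x)))"
    by (intro continuous_intros continuous_on_compose2[OF assms]) auto
  then show "isCont (\<lambda>x :: real ^ 'n. complex_of_real (f (norm x))) 0"
    by (simp add: continuous_on_eq_continuous_at)
  fix m and x :: "nat \<Rightarrow> real ^ 'n" and \<xi> :: "nat \<Rightarrow> complex"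
  show "0 \<le> (\<Sum>j<m. \<Sum>k<m. \<xi> k * cnj (\<xi> j) * complex_of_real (f (norm (x k - x j))))"
    using norm_form_nonneg[where I = "{..<m}" and u = "\<lambda>k. Re (\<xi> k)" and x = x]
      norm_form_nonneg[where I = "{..<m}" and u = "\<lambda>k. Im (\<xi> k)" and x = x]
    by (subst hermitian_form_eq) (auto simp: norm_minus_commute less_eq_complex_def)
qed

lemma strongly_positive_definite_norm:
  fixes X :: "nat \<Rightarrow> real ^ 'n"
  assumes "continuous_on {0..} f" "\<not> f constant_on {0..}" "separation X > 0"
  shows "strongly_positive_definite X (\<lambda>x. complex_of_real (f (norm x)))"
proof -
  have "\<exists>c>0. \<forall>I u. finite I \<longrightarrow> c * (\<Sum>k\<in>I. (u k)\<^sup>2) \<le>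
      (\<Sum>j\<in>I. \<Sum>k\<in>I. u k * u j * f (norm (X k - X j)))"
    by (rule norm_form_lower_bound[OF assms(2,3) separation_le])
  then obtain c where c: "c > 0" "\<forall>I u. finite I \<longrightarrow> c * (\<Sum>k\<in>I. (u k)\<^sup>2) \<le>
      (\<Sum>j\<in>I. \<Sum>k\<in>I. u k * u j * f (norm (X k - X j)))"
    by (elim exE conjE) (rule that)
  have "complex_of_real (c * (\<Sum>k<m. (cmod (\<xi> k))\<^sup>2)) \<le>
      (\<Sum>j<m. \<Sum>k<m. \<xi> k * cnj (\<xi> j) * complex_of_real (f (norm (X k - X j))))"
    for m and \<xi> :: "nat \<Rightarrow> complex"
  proof (subst hermitian_form_eq)
    show "f (norm (X j - X k)) = f (norm (X k - X j))" for j k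
      by (simp add: norm_minus_commute)
    have "c * (\<Sum>k<m. (cmod (\<xi> k))\<^sup>2) = c * (\<Sum>k<m. (Re (\<xi> k))\<^sup>2) + c * (\<Sum>k<m. (Im (\<xi> k))\<^sup>2)"
      by (simp add: cmod_power2 sum.distrib distrib_left)
    then show "complex_of_real (c * (\<Sum>k<m. (cmod (\<xi> k))\<^sup>2)) \<le> complex_of_real
        ((\<Sum>j<m. \<Sum>k<m. Re (\<xi> k) * Re (\<xi> j) * f (norm (X k - X j))) +
         (\<Sum>j<m. \<Sum>k<m. Im (\<xi> k) * Im (\<xi> j) * f (norm (X k - X j))))"
      using c(2)[rule_format, of "{..<m}" "\<lambda>k. Re (\<xi> k)"] c(2)[rule_format, of "{..<m}" "\<lambda>k. Im (\<xi> k)"]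
      by (simp add: less_eq_complex_def)
  qed
  with c(1) show ?thesis
    unfolding strongly_positive_definite_def by (blast intro: positive_definite_norm assms)
qed

end

section \<open>Operators on \<open>l2\<close>\<close>

text \<open>Bounds on all finite sections give membership and the norm estimate at once, so
  inequalities for \<open>L2_set\<close> carry over to \<open>l2\<close>.\<close>

lemma l2I:
  assumes "\<And>n. L2_set (\<lambda>k. cmod (x k)) {..<n} \<le> C"
  shows l2_memI: "x \<in> l2" and l2_norm_leI: "l2_norm x \<le> C"
proof -
  have C: "C \<ge> 0"
    using assms[of 0] by simp
  have le: "(\<Sum>k<n. (cmod (x k))\<^sup>2) \<le> C\<^sup>2" for n
    using assms[of n] C by (simp add: L2_set_def sqrt_le_D)
  then have summ: "summable (\<lambda>k. (cmod (x k))\<^sup>2)"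
    by (intro summableI_nonneg_bounded) auto
  then show "x \<in> l2"
    by (simp add: l2_def)
  have "(\<Sum>k. (cmod (x k))\<^sup>2) \<le> C\<^sup>2"
    by (rule suminf_le_const[OF summ le])
  then show "l2_norm x \<le> C"
    using C by (simp add: l2_norm_def real_le_lsqrt)
qed

lemma L2_set_le_l2_norm:
  assumes "x \<in> l2" "finite A"
  shows "L2_set (\<lambda>k. cmod (x k)) A \<le> l2_norm x"
  unfolding L2_set_def l2_norm_def
  using assms by (intro real_sqrt_le_mono sum_le_suminf) (auto simp: l2_def)

lemma l2_norm_nonneg: "x \<in> l2 \<Longrightarrow> 0 \<le> l2_norm x"
  unfolding l2_norm_def l2_def by (auto intro: suminf_nonneg)

lemma l2_norm_power2: "x \<in> l2 \<Longrightarrow> (l2_norm x)\<^sup>2 = (\<Sum>k. (cmod (x k))\<^sup>2)"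
  unfolding l2_norm_def l2_def by (auto intro: suminf_nonneg)

lemma cmod_le_l2_norm: "x \<in> l2 \<Longrightarrow> cmod (x k) \<le> l2_norm x"
  using L2_set_le_l2_norm[of x "{k}"] by simp

lemma l2_norm_eq_0: "x \<in> l2 \<Longrightarrow> l2_norm x \<le> 0 \<Longrightarrow> x k = 0"
  using cmod_le_l2_norm[of x k] norm_le_zero_iff order_trans by blast

lemma
  assumes "x \<in> l2" "y \<in> l2"
  shows l2_add: "(\<lambda>k. x k + y k) \<in> l2"
    and l2_norm_triangle: "l2_norm (\<lambda>k. x k + y k) \<le> l2_norm x + l2_norm y"
proof -
  have "L2_set (\<lambda>k. cmod (x k + y k)) {..<n} \<le> l2_norm x + l2_norm y" for n
  proof -
    have "L2_set (\<lambda>k. cmod (x k + y k)) {..<n} \<le> L2_set (\<lambda>k. cmod (x k) + cmod (y k)) {..<n}"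
      by (intro L2_set_mono norm_triangle_ineq) auto
    also have "\<dots> \<le> L2_set (\<lambda>k. cmod (x k)) {..<n} + L2_set (\<lambda>k. cmod (y k)) {..<n}"
      by (rule L2_set_triangle_ineq)
    also have "\<dots> \<le> l2_norm x + l2_norm y"
      using assms by (intro add_mono L2_set_le_l2_norm) auto
    finally show ?thesis .
  qed
  then show "(\<lambda>k. x k + y k) \<in> l2" "l2_norm (\<lambda>k. x k + y k) \<le> l2_norm x + l2_norm y"
    by (rule l2I)+
qed

lemma
  assumes "x \<in> l2"
  shows l2_scale: "(\<lambda>k. c * x k) \<in> l2"
    and l2_norm_scale: "l2_norm (\<lambda>k. c * x k) = cmod c * l2_norm x"
  using assms
  by (auto simp: l2_def l2_norm_def norm_mult power_mult_distrib suminf_mult real_sqrt_mult)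

lemma l2_diff: "x \<in> l2 \<Longrightarrow> y \<in> l2 \<Longrightarrow> (\<lambda>k. x k - y k) \<in> l2"
  using l2_add[of x "\<lambda>k. - 1 * y k"] l2_scale[of y "- 1"] by simp

lemma l2_norm_triangle_diff:
  assumes "x \<in> l2" "y \<in> l2" "z \<in> l2"
  shows "l2_norm (\<lambda>k. x k - z k) \<le> l2_norm (\<lambda>k. x k - y k) + l2_norm (\<lambda>k. y k - z k)"
  using l2_norm_triangle[of "\<lambda>k. x k - y k" "\<lambda>k. y k - z k"] assms by (simp add: l2_diff)

lemma l2_eq_0_beyond:
  assumes "\<And>k. k \<ge> n \<Longrightarrow> x k = 0"
  shows "x \<in> l2"
  unfolding l2_def using assms by (auto intro!: summable_finite[of "{..<n}"]) (meson leI)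

lemma
  assumes "x \<in> l2" "y \<in> l2"
  shows summable_norm_l2_inner: "summable (\<lambda>k. cmod (x k * cnj (y k)))"
    and cmod_l2_inner_le: "cmod (l2_inner x y) \<le> l2_norm x * l2_norm y"
proof -
  have le: "(\<Sum>k<n. cmod (x k * cnj (y k))) \<le> l2_norm x * l2_norm y" for n
  proof -
    have "(\<Sum>k<n. cmod (x k * cnj (y k))) = (\<Sum>k<n. \<bar>cmod (x k)\<bar> * \<bar>cmod (y k)\<bar>)"
      by (simp add: norm_mult)
    also have "\<dots> \<le> L2_set (\<lambda>k. cmod (x k)) {..<n} * L2_set (\<lambda>k. cmod (y k)) {..<n}"
      by (rule L2_set_mult_ineq)
    also have "\<dots> \<le> l2_norm x * l2_norm y"
      using assms by (intro mult_mono L2_set_le_l2_norm l2_norm_nonneg) auto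
    finally show ?thesis .
  qed
  then show summ: "summable (\<lambda>k. cmod (x k * cnj (y k)))"
    by (intro summableI_nonneg_bounded) auto
  have "cmod (l2_inner x y) \<le> (\<Sum>k. cmod (x k * cnj (y k)))"
    unfolding l2_inner_def by (rule summable_norm[OF summ])
  also have "\<dots> \<le> l2_norm x * l2_norm y"
    by (rule suminf_le_const[OF summ le])
  finally show "cmod (l2_inner x y) \<le> l2_norm x * l2_norm y" .
qed

lemma summable_l2_inner: "x \<in> l2 \<Longrightarrow> y \<in> l2 \<Longrightarrow> summable (\<lambda>k. x k * cnj (y k))"
  by (rule summable_norm_cancel[OF summable_norm_l2_inner])

lemma l2_inner_diff_left:
  "x \<in> l2 \<Longrightarrow> x' \<in> l2 \<Longrightarrow> y \<in> l2 \<Longrightarrow> l2_inner (\<lambda>k. x k - x' k) y = l2_inner x y - l2_inner x' y"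
  by (simp add: l2_inner_def left_diff_distrib suminf_diff summable_l2_inner)

lemma l2_inner_scale_left:
  "x \<in> l2 \<Longrightarrow> y \<in> l2 \<Longrightarrow> l2_inner (\<lambda>k. c * x k) y = c * l2_inner x y"
  by (simp add: l2_inner_def mult.assoc suminf_mult summable_l2_inner)

lemma l2_inner_commute: "x \<in> l2 \<Longrightarrow> y \<in> l2 \<Longrightarrow> l2_inner y x = cnj (l2_inner x y)"
  unfolding l2_inner_def
  using sums_unique[OF sums_cnj[THEN iffD2, OF summable_sums[OF summable_l2_inner[of x y]]]]
  by (simp add: mult.commute)

lemma l2_inner_diff_right:
  "x \<in> l2 \<Longrightarrow> y \<in> l2 \<Longrightarrow> y' \<in> l2 \<Longrightarrow> l2_inner x (\<lambda>k. y k - y' k) = l2_inner x y - l2_inner x y'"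
  by (simp add: l2_inner_def right_diff_distrib suminf_diff summable_l2_inner)

lemma l2_inner_scale_right:
  "x \<in> l2 \<Longrightarrow> y \<in> l2 \<Longrightarrow> l2_inner x (\<lambda>k. c * y k) = cnj c * l2_inner x y"
  by (simp add: l2_inner_def mult.left_commute suminf_mult summable_l2_inner)

lemma l2_inner_self: "x \<in> l2 \<Longrightarrow> l2_inner x x = complex_of_real ((l2_norm x)\<^sup>2)"
  by (simp add: l2_inner_def l2_norm_power2 l2_def complex_norm_square[symmetric] suminf_of_real)

text \<open>Completeness in the form a fixed-point iteration needs: geometrically decaying
  increments and an explicit rate. The limit is taken coordinatewise, and the tail estimate survives
  on finite sections.\<close>

lemma l2_complete:
  assumes x: "\<And>n. x n \<in> l2" and q: "0 \<le> q" "q < 1"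
    and step: "\<And>n. l2_norm (\<lambda>k. x (Suc n) k - x n k) \<le> K * q ^ n"
  shows "\<exists>y\<in>l2. \<forall>n. l2_norm (\<lambda>k. y k - x n k) \<le> K * q ^ n / (1 - q)"
proof -
  have K: "K \<ge> 0"
    using order_trans[OF l2_norm_nonneg[OF l2_diff[OF x x]] step[of 0]] by simp
  \<comment> \<open>The exact partial geometric sum is kept because the weaker bound without the
    factor 1 - q^p is not inductive.\<close>
  have "l2_norm (\<lambda>k. x (n + p) k - x n k) \<le> K * q ^ n * (1 - q ^ p) / (1 - q)" for n p
  proof (induction p)
    case 0
    show ?case
      by (simp add: l2_norm_def)
  next
    case (Suc p)
    have "l2_norm (\<lambda>k. x (n + Suc p) k - x n k) \<le>
        l2_norm (\<lambda>k. x (Suc (n + p)) k - x (n + p) k) + l2_norm (\<lambda>k. x (n + p) k - x n k)"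
      using l2_norm_triangle_diff[of "x (n + Suc p)" "x (n + p)" "x n"] x by simp
    also have "\<dots> \<le> K * q ^ (n + p) + K * q ^ n * (1 - q ^ p) / (1 - q)"
      by (intro add_mono step Suc.IH)
    also have "\<dots> = K * q ^ n * (1 - q ^ Suc p) / (1 - q)"
      using q by (simp add: field_simps power_add)
    finally show ?case .
  qed
  moreover have "K * q ^ n * (1 - q ^ p) / (1 - q) \<le> K * q ^ n / (1 - q)" for n p
    using K q by (intro divide_right_mono mult_left_le) auto
  ultimately have tail: "l2_norm (\<lambda>k. x (n + p) k - x n k) \<le> K * q ^ n / (1 - q)" for n p
    using order_trans by blast
  have "\<exists>l. (\<lambda>n. x n k) \<longlonglongrightarrow> l" for k
  proof -
    have "summable (\<lambda>n. x (Suc n) k - x n k)"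
    proof (rule summable_comparison_test')
      show "summable (\<lambda>n. K * q ^ n)"
        using q by (intro summable_mult summable_geometric) simp
      show "norm (x (Suc n) k - x n k) \<le> K * q ^ n" if "n \<ge> 0" for n
        using cmod_le_l2_norm[OF l2_diff[OF x x]] step order_trans by blast
    qed
    then have "(\<lambda>n. \<Sum>i<n. x (Suc i) k - x i k) \<longlonglongrightarrow> (\<Sum>n. x (Suc n) k - x n k)"
      by (rule summable_LIMSEQ)
    then have "(\<lambda>n. x n k - x 0 k + x 0 k) \<longlonglongrightarrow> (\<Sum>n. x (Suc n) k - x n k) + x 0 k"
      unfolding sum_lessThan_telescope[of "\<lambda>n. x n k"] by (intro tendsto_intros)
    then show ?thesis
      by auto
  qed
  then obtain y where y: "\<And>k. (\<lambda>n. x n k) \<longlonglongrightarrow> y k"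
    by metis
  have le: "L2_set (\<lambda>k. cmod (y k - x n k)) {..<N} \<le> K * q ^ n / (1 - q)" for n N
  proof (rule LIMSEQ_le_const2)
    have "(\<lambda>p. x (n + p) k) \<longlonglongrightarrow> y k" for k
      using LIMSEQ_ignore_initial_segment[OF y, of n k] by (simp add: add.commute)
    then show "(\<lambda>p. L2_set (\<lambda>k. cmod (x (n + p) k - x n k)) {..<N}) \<longlonglongrightarrow>
        L2_set (\<lambda>k. cmod (y k - x n k)) {..<N}"
      unfolding L2_set_def by (intro tendsto_intros)
    show "\<exists>N0. \<forall>p\<ge>N0. L2_set (\<lambda>k. cmod (x (n + p) k - x n k)) {..<N} \<le> K * q ^ n / (1 - q)"
      using L2_set_le_l2_norm[OF l2_diff[OF x x]] tail order_trans by blast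
  qed
  have "(\<lambda>k. (y k - x 0 k) + x 0 k) \<in> l2"
    by (intro l2_add x l2_memI[OF le])
  then show ?thesis
    using l2_norm_leI[OF le] by auto
qed

section \<open>Bounded operators and their matrices\<close>

lemma l2_bounded_operatorE:
  assumes "l2_bounded_operator A"
  obtains C where "C > 0" "\<And>x. x \<in> l2 \<Longrightarrow> l2_norm (A x) \<le> C * l2_norm x"
proof -
  obtain C where C: "\<And>x. x \<in> l2 \<Longrightarrow> l2_norm (A x) \<le> C * l2_norm x"
    using assms unfolding l2_bounded_operator_def by blast
  have "l2_norm (A x) \<le> max C 1 * l2_norm x" if "x \<in> l2" for x
    using C[OF that] l2_norm_nonneg[OF that]
    by (meson max.cobounded1 mult_right_mono order_trans)
  then show ?thesis
    using that[of "max C 1"] by simp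
qed

lemma l2_bounded_operator_mem: "l2_bounded_operator A \<Longrightarrow> x \<in> l2 \<Longrightarrow> A x \<in> l2"
  by (simp add: l2_bounded_operator_def)

lemma l2_bounded_operator_scale:
  "l2_bounded_operator A \<Longrightarrow> x \<in> l2 \<Longrightarrow> A (\<lambda>k. c * x k) = (\<lambda>k. c * A x k)"
  by (simp add: l2_bounded_operator_def)

lemma l2_bounded_operator_add:
  "l2_bounded_operator A \<Longrightarrow> x \<in> l2 \<Longrightarrow> y \<in> l2 \<Longrightarrow> A (\<lambda>k. x k + y k) = (\<lambda>k. A x k + A y k)"
  by (simp add: l2_bounded_operator_def)

lemma l2_bounded_operator_diff:
  assumes "l2_bounded_operator A" "x \<in> l2" "y \<in> l2"
  shows "A (\<lambda>k. x k - y k) = (\<lambda>k. A x k - A y k)"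
  using l2_bounded_operator_add[OF assms(1,2) l2_scale[OF assms(3)], of "- 1"]
    l2_bounded_operator_scale[OF assms(1,3), of "- 1"] by simp

text \<open>The squared norm of the remainder is the total sum minus a partial sum.\<close>

lemma truncation_tendsto:
  assumes "x \<in> l2"
  shows "(\<lambda>N. l2_norm (\<lambda>k. x k - (if k < N then x k else 0))) \<longlonglongrightarrow> 0"
proof -
  have summ: "summable (\<lambda>k. (cmod (x k))\<^sup>2)"
    using assms by (simp add: l2_def)
  have "(l2_norm (\<lambda>k. x k - (if k < N then x k else 0))) =
      sqrt ((\<Sum>k. (cmod (x k))\<^sup>2) - (\<Sum>k<N. (cmod (x k))\<^sup>2))" for N
  proof -
    have "(\<lambda>k. if k < N then (cmod (x k))\<^sup>2 else 0) sums (\<Sum>k<N. (cmod (x k))\<^sup>2)"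
      using sums_If_finite[of "\<lambda>k. k < N" "\<lambda>k. (cmod (x k))\<^sup>2"] by (simp add: lessThan_def)
    then have "(\<lambda>k. (cmod (x k))\<^sup>2 - (if k < N then (cmod (x k))\<^sup>2 else 0)) sums
        ((\<Sum>k. (cmod (x k))\<^sup>2) - (\<Sum>k<N. (cmod (x k))\<^sup>2))"
      using summ by (intro sums_diff summable_sums)
    moreover have "(\<lambda>k. (cmod (x k))\<^sup>2 - (if k < N then (cmod (x k))\<^sup>2 else 0)) =
        (\<lambda>k. (cmod (x k - (if k < N then x k else 0)))\<^sup>2)"
      by auto
    ultimately show ?thesis
      by (simp add: l2_norm_def sums_iff)
  qed
  moreover have "(\<lambda>N. sqrt ((\<Sum>k. (cmod (x k))\<^sup>2) - (\<Sum>k<N. (cmod (x k))\<^sup>2))) \<longlonglongrightarrow>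
      sqrt ((\<Sum>k. (cmod (x k))\<^sup>2) - (\<Sum>k. (cmod (x k))\<^sup>2))"
    by (intro tendsto_intros summable_LIMSEQ summ)
  ultimately show ?thesis
    by simp
qed

text \<open>A rectangular partial sum is the inner product of \<open>A\<close> applied to a
  truncation of \<open>x\<close> with a truncation of \<open>y\<close>. Boundedness of
  \<open>A\<close> then gives convergence with the two truncation levels independent of each
  other.\<close>

lemma matrix_defines_l2_operatorI:
  assumes A: "l2_bounded_operator A"
    and sums: "\<And>x j. x \<in> l2 \<Longrightarrow> (\<lambda>k. a k j * x k) sums A x j"
  shows "matrix_defines_l2_operator a A"
  unfolding matrix_defines_l2_operator_def
proof (intro conjI ballI A)
  fix x y :: "nat \<Rightarrow> complex" assume x: "x \<in> l2" and y: "y \<in> l2"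
  obtain C where C: "C > 0" "\<And>x. x \<in> l2 \<Longrightarrow> l2_norm (A x) \<le> C * l2_norm x"
    using l2_bounded_operatorE[OF A] by blast
  define xt where "xt M = (\<lambda>k. if k < M then x k else 0)" for M
  define yt where "yt N = (\<lambda>k. if k < N then y k else 0)" for N
  define ex where "ex M = l2_norm (\<lambda>k. x k - xt M k)" for M
  define ey where "ey N = l2_norm (\<lambda>k. y k - yt N k)" for N
  have mem: "xt M \<in> l2" "yt N \<in> l2" for M N
    unfolding xt_def yt_def by (auto intro: l2_eq_0_beyond[of M] l2_eq_0_beyond[of N])
  have A_xt: "A (xt M) j = (\<Sum>k<M. a k j * x k)" for M j
  proof -
    have "(\<lambda>k. if k < M then a k j * x k else 0) sums (\<Sum>k<M. a k j * x k)"
      using sums_If_finite[of "\<lambda>k. k < M" "\<lambda>k. a k j * x k"] by (simp add: lessThan_def)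
    moreover have "(\<lambda>k. if k < M then a k j * x k else 0) = (\<lambda>k. a k j * xt M k)"
      by (auto simp: xt_def)
    ultimately show ?thesis
      using sums[OF mem(1)] sums_unique2 by metis
  qed
  have partial: "(\<Sum>k<M. \<Sum>j<N. a k j * x k * cnj (y j)) = l2_inner (A (xt M)) (yt N)" for M N
  proof -
    have "l2_inner (A (xt M)) (yt N) = (\<Sum>j. if j < N then A (xt M) j * cnj (y j) else 0)"
      unfolding l2_inner_def yt_def by (intro suminf_cong) auto
    also have "\<dots> = (\<Sum>j<N. A (xt M) j * cnj (y j))"
      using sums_If_finite[of "\<lambda>j. j < N" "\<lambda>j. A (xt M) j * cnj (y j)"]
      by (simp add: lessThan_def sums_iff)
    also have "\<dots> = (\<Sum>j<N. \<Sum>k<M. a k j * x k * cnj (y j))"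
      by (simp add: A_xt sum_distrib_right)
    finally show ?thesis
      by (simp add: sum.swap[of _ "{..<M}"])
  qed
  have diff_le: "cmod (l2_inner (A (xt M)) (yt N) - l2_inner (A x) y) \<le>
      C * ex M * l2_norm y + C * (l2_norm x + ex M) * ey N" for M N
  proof -
    have "l2_inner (A x) y - l2_inner (A (xt M)) (yt N) =
        l2_inner (A (\<lambda>k. x k - xt M k)) y + l2_inner (A (xt M)) (\<lambda>k. y k - yt N k)"
      using x y mem l2_bounded_operator_mem[OF A]
      by (simp add: l2_bounded_operator_diff[OF A] l2_inner_diff_left l2_inner_diff_right)
    then have "cmod (l2_inner (A (xt M)) (yt N) - l2_inner (A x) y) \<le>
        cmod (l2_inner (A (\<lambda>k. x k - xt M k)) y) + cmod (l2_inner (A (xt M)) (\<lambda>k. y k - yt N k))"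
      by (metis norm_minus_commute norm_triangle_ineq)
    also have "\<dots> \<le> l2_norm (A (\<lambda>k. x k - xt M k)) * l2_norm y +
        l2_norm (A (xt M)) * l2_norm (\<lambda>k. y k - yt N k)"
      by (intro add_mono cmod_l2_inner_le l2_bounded_operator_mem[OF A] l2_diff x y mem)
    also have "\<dots> \<le> C * ex M * l2_norm y + C * (l2_norm x + ex M) * ey N"
    proof (intro add_mono mult_mono order_refl)
      show "l2_norm (A (\<lambda>k. x k - xt M k)) \<le> C * ex M"
        unfolding ex_def by (intro C l2_diff x mem)
      have "l2_norm (A (xt M)) \<le> C * l2_norm (xt M)"
        by (intro C mem)
      \<comment> \<open>The truncation is \<open>x\<close> minus its error, so the triangle
        inequality gives a bound that is sufficient because \<open>ex\<close> tends to 0.\<close>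
      also have "l2_norm (xt M) \<le> l2_norm x + ex M"
        using l2_norm_triangle[OF x l2_scale[OF l2_diff[OF x mem(1)[of M]], of "- 1"]]
        by (simp add: l2_norm_scale[OF l2_diff[OF x mem(1)], of "- 1", simplified] ex_def)
      finally show "l2_norm (A (xt M)) \<le> C * (l2_norm x + ex M)"
        using C by simp
    qed (use C in \<open>auto simp: ex_def ey_def intro!: mult_nonneg_nonneg add_nonneg_nonneg
        l2_norm_nonneg l2_diff x y mem l2_bounded_operator_mem[OF A]\<close>)
    finally show ?thesis .
  qed
  have "ex \<longlonglongrightarrow> 0" "ey \<longlonglongrightarrow> 0"
    unfolding ex_def ey_def xt_def yt_def using x y by (auto intro: truncation_tendsto)
  then have lim: "((\<lambda>p. ex (fst p)) \<longlongrightarrow> 0) (sequentially \<times>\<^sub>F sequentially)"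
      "((\<lambda>p. ey (snd p)) \<longlongrightarrow> 0) (sequentially \<times>\<^sub>F sequentially)"
    by (auto intro: filterlim_compose filterlim_fst filterlim_snd)
  have "((\<lambda>p. C * ex (fst p) * l2_norm y + C * (l2_norm x + ex (fst p)) * ey (snd p)) \<longlongrightarrow>
      C * 0 * l2_norm y + C * (l2_norm x + 0) * 0) (sequentially \<times>\<^sub>F sequentially)"
    by (intro tendsto_intros lim)
  then have g: "((\<lambda>p. C * ex (fst p) * l2_norm y + C * (l2_norm x + ex (fst p)) * ey (snd p)) \<longlongrightarrow> 0)
      (sequentially \<times>\<^sub>F sequentially)"
    by simp
  have "((\<lambda>p. l2_inner (A (xt (fst p))) (yt (snd p)) - l2_inner (A x) y) \<longlongrightarrow> 0)
      (sequentially \<times>\<^sub>F sequentially)"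
    by (rule Lim_null_comparison[OF always_eventually g]) (intro allI diff_le)
  then show "((\<lambda>(M, N). \<Sum>k<M. \<Sum>j<N. a k j * x k * cnj (y j)) \<longlongrightarrow> l2_inner (A x) y)
      (sequentially \<times>\<^sub>F sequentially)"
    unfolding partial by (simp add: case_prod_unfold LIM_zero_cancel)
qed

text \<open>Cauchy-Schwarz with each weight split into two square roots; by symmetry the row bound
  also controls columns, and the operator norm is at most \<open>M\<close>.\<close>

lemma schur_test:
  fixes w :: "nat \<Rightarrow> nat \<Rightarrow> real"
  assumes nonneg: "\<And>j k. 0 \<le> w j k" and sym: "\<And>j k. w j k = w k j"
    and row: "\<And>j n. (\<Sum>k<n. w j k) \<le> M"
  shows "\<exists>A. matrix_defines_l2_operator (\<lambda>k j. complex_of_real (w k j)) A"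
proof
  define A where "A x = (\<lambda>j. \<Sum>k. complex_of_real (w k j) * x k)" for x
  have summ: "summable (\<lambda>k. complex_of_real (w k j) * x k)" if x: "x \<in> l2" for x j
  proof (rule summable_comparison_test')
    \<comment> \<open>Columns are summable and the entries of \<open>x\<close> are bounded by its
      norm, so the series defining \<open>A\<close> converges absolutely.\<close>
    have "summable (\<lambda>k. w k j)"
      by (rule summableI_nonneg_bounded[of _ M]) (use nonneg row[of j] sym[of j] in auto)
    then show "summable (\<lambda>k. w k j * l2_norm x)"
      by (rule summable_mult2)
    show "norm (complex_of_real (w k j) * x k) \<le> w k j * l2_norm x" if "k \<ge> 0" for k
      using nonneg cmod_le_l2_norm[OF x] by (simp add: norm_mult mult_left_mono)
  qed
  have M: "M \<ge> 0"
    using row[of 0 0] by simp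
  have finite_bound: "(\<Sum>j<N. (cmod (\<Sum>k<n. complex_of_real (w k j) * x k))\<^sup>2) \<le>
      M\<^sup>2 * (\<Sum>k<n. (cmod (x k))\<^sup>2)" for n N and x :: "nat \<Rightarrow> complex"
  proof -
    have "(cmod (\<Sum>k<n. complex_of_real (w k j) * x k))\<^sup>2 \<le> M * (\<Sum>k<n. w k j * (cmod (x k))\<^sup>2)" for j
    proof -
      have "cmod (\<Sum>k<n. complex_of_real (w k j) * x k) \<le> (\<Sum>k<n. w k j * cmod (x k))"
        by (rule order_trans[OF norm_sum]) (simp add: norm_mult nonneg)
      then have "(cmod (\<Sum>k<n. complex_of_real (w k j) * x k))\<^sup>2 \<le> (\<Sum>k<n. w k j * cmod (x k))\<^sup>2"
        by (intro power_mono) auto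
      also have "\<dots> = (\<Sum>k<n. sqrt (w k j) * (sqrt (w k j) * cmod (x k)))\<^sup>2"
        by (simp add: nonneg flip: mult.assoc)
      also have "\<dots> \<le> (\<Sum>k<n. (sqrt (w k j))\<^sup>2) * (\<Sum>k<n. (sqrt (w k j) * cmod (x k))\<^sup>2)"
        by (rule Cauchy_Schwarz_ineq_sum)
      also have "\<dots> = (\<Sum>k<n. w j k) * (\<Sum>k<n. w k j * (cmod (x k))\<^sup>2)"
        by (simp add: power_mult_distrib nonneg sym[of j])
      also have "\<dots> \<le> M * (\<Sum>k<n. w k j * (cmod (x k))\<^sup>2)"
        by (intro mult_right_mono row sum_nonneg mult_nonneg_nonneg nonneg) auto
      finally show ?thesis .
    qed
    then have "(\<Sum>j<N. (cmod (\<Sum>k<n. complex_of_real (w k j) * x k))\<^sup>2) \<le>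
        (\<Sum>j<N. M * (\<Sum>k<n. w k j * (cmod (x k))\<^sup>2))"
      by (intro sum_mono)
    also have "\<dots> = M * (\<Sum>k<n. (\<Sum>j<N. w k j) * (cmod (x k))\<^sup>2)"
      by (simp add: sum.swap[of _ "{..<n}"] flip: sum_distrib_left sum_distrib_right)
    also have "\<dots> \<le> M * (\<Sum>k<n. M * (cmod (x k))\<^sup>2)"
      by (intro mult_left_mono sum_mono mult_right_mono row M) auto
    finally show ?thesis
      by (simp add: power2_eq_square mult.assoc flip: sum_distrib_left)
  qed
  have bound: "L2_set (\<lambda>j. cmod (A x j)) {..<N} \<le> M * l2_norm x" if x: "x \<in> l2" for x N
  proof -
    \<comment> \<open>The estimate for finite sections is uniform in both sizes; the input size goes
      to infinity first, for fixed \<open>N\<close>.\<close>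
    have "(\<Sum>j<N. (cmod (A x j))\<^sup>2) \<le> (M * l2_norm x)\<^sup>2"
    proof (rule LIMSEQ_le_const2)
      show "(\<lambda>n. \<Sum>j<N. (cmod (\<Sum>k<n. complex_of_real (w k j) * x k))\<^sup>2) \<longlonglongrightarrow>
          (\<Sum>j<N. (cmod (A x j))\<^sup>2)"
        unfolding A_def by (intro tendsto_intros summable_LIMSEQ summ x)
      have "(\<Sum>j<N. (cmod (\<Sum>k<n. complex_of_real (w k j) * x k))\<^sup>2) \<le> (M * l2_norm x)\<^sup>2" for n
      proof -
        have "(\<Sum>k<n. (cmod (x k))\<^sup>2) \<le> (l2_norm x)\<^sup>2"
          unfolding l2_norm_power2[OF x] using x by (intro sum_le_suminf) (auto simp: l2_def)
        then show ?thesis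
          unfolding power_mult_distrib
          by (intro order_trans[OF finite_bound] mult_left_mono) auto
      qed
      then show "\<exists>n0. \<forall>n\<ge>n0. (\<Sum>j<N. (cmod (\<Sum>k<n. complex_of_real (w k j) * x k))\<^sup>2) \<le>
          (M * l2_norm x)\<^sup>2"
        by blast
    qed
    then show ?thesis
      unfolding L2_set_def using M l2_norm_nonneg[OF x] by (intro real_le_lsqrt) auto
  qed
  show "matrix_defines_l2_operator (\<lambda>k j. complex_of_real (w k j)) A"
  proof (rule matrix_defines_l2_operatorI)
    show "l2_bounded_operator A"
      unfolding l2_bounded_operator_def
    proof (intro conjI ballI allI exI[of _ M])
      fix x y :: "nat \<Rightarrow> complex" and c assume x: "x \<in> l2"
      show "A x \<in> l2" "l2_norm (A x) \<le> M * l2_norm x"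
        using l2I[OF bound[OF x]] by auto
      show "A (\<lambda>k. c * x k) = (\<lambda>k. c * A x k)"
        using x by (simp add: A_def mult.left_commute[of _ c] suminf_mult summ)
      assume y: "y \<in> l2"
      show "A (\<lambda>k. x k + y k) = (\<lambda>k. A x k + A y k)"
        using x y by (simp add: A_def distrib_left suminf_add summ)
    qed
    show "(\<lambda>k. complex_of_real (w k j) * x k) sums A x j" if "x \<in> l2" for x j
      unfolding A_def by (intro summable_sums summ that)
  qed
qed

section \<open>Inverses of coercive operators\<close>

lemma l2_inner_diff_scale:
  assumes "x \<in> l2" "y \<in> l2" "u \<in> l2" "v \<in> l2"
  shows "l2_inner (\<lambda>k. x k - c * y k) (\<lambda>k. u k - c * v k) =
    l2_inner x u - cnj c * l2_inner x v - (c * l2_inner y u - c * cnj c * l2_inner y v)"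
  using assms
  by (simp add: l2_inner_diff_left l2_inner_diff_right l2_inner_scale_left l2_inner_scale_right
      l2_diff l2_scale right_diff_distrib mult.assoc)

text \<open>Coercivity yields c |x| \<le> |A x|, hence injectivity and the bound 1/c for the
  inverse. Surjectivity holds because x - \<gamma> A x is a contraction for a suitable \<gamma>, so
  that iteration solves the equation.\<close>

lemma l2_bounded_inverseI:
  assumes A: "l2_bounded_operator A" and c: "c > 0"
    and coercive: "\<And>x. x \<in> l2 \<Longrightarrow> c * (l2_norm x)\<^sup>2 \<le> Re (l2_inner (A x) x)"
  shows "l2_bounded_inverse A"
proof -
  note mem = l2_bounded_operator_mem[OF A]
  obtain C0 where C0: "C0 > 0" "\<And>x. x \<in> l2 \<Longrightarrow> l2_norm (A x) \<le> C0 * l2_norm x"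
    using l2_bounded_operatorE[OF A] by blast
  \<comment> \<open>Enlarging the bound to at least \<open>c\<close> keeps 1 - c^2/C^2 nonnegative,
    so that \<open>q\<close> is a genuine contraction factor.\<close>
  define C where "C = max C0 c"
  have C: "C > 0" "c \<le> C"
    using c by (auto simp: C_def)
  have C_bound: "l2_norm (A x) \<le> C * l2_norm x" if "x \<in> l2" for x
    using C0(2)[OF that] l2_norm_nonneg[OF that] mult_right_mono[of C0 C "l2_norm x"]
    by (simp add: C_def)
  have lower: "c * l2_norm x \<le> l2_norm (A x)" if x: "x \<in> l2" for x
  proof (cases "l2_norm x = 0")
    case False
    have "c * l2_norm x * l2_norm x \<le> l2_norm (A x) * l2_norm x"
      using coercive[OF x] complex_Re_le_cmod[of "l2_inner (A x) x"] cmod_l2_inner_le[OF mem[OF x] x]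
      by (simp add: power2_eq_square mult.assoc)
    then show ?thesis
      using False l2_norm_nonneg[OF x] by simp
  qed (use l2_norm_nonneg[OF mem[OF x]] in simp)
  have inj: "x = y" if x: "x \<in> l2" and y: "y \<in> l2" and eq: "A x = A y" for x y
  proof
    fix k
    have "c * l2_norm (\<lambda>k. x k - y k) \<le> 0"
      using lower[OF l2_diff[OF x y]] by (simp add: l2_bounded_operator_diff[OF A x y] eq l2_norm_def)
    then have "l2_norm (\<lambda>k. x k - y k) \<le> 0"
      using c by (simp add: mult_le_0_iff)
    then show "x k = y k"
      using l2_norm_eq_0[OF l2_diff[OF x y], of k] by simp
  qed
  \<comment> \<open>This is the minimiser of 1 - 2 \<gamma> c + \<gamma>^2 C^2, the bound for the
    squared contraction factor; the minimum is q^2.\<close>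
  define \<gamma> where "\<gamma> = c / C\<^sup>2"
  define q where "q = sqrt (1 - c\<^sup>2 / C\<^sup>2)"
  have \<gamma>: "\<gamma> > 0"
    using c C by (simp add: \<gamma>_def)
  have q: "0 \<le> q" "q < 1" "q\<^sup>2 = 1 - c\<^sup>2 / C\<^sup>2"
    using c C power_mono[of c C 2] by (auto simp: q_def)
  have contraction: "l2_norm (\<lambda>k. x k - \<gamma> * A x k) \<le> q * l2_norm x" if x: "x \<in> l2" for x
  proof -
    let ?D = "\<lambda>k. x k - \<gamma> * A x k"
    have sA: "(\<lambda>k. \<gamma> * A x k) \<in> l2"
      by (intro l2_scale mem x)
    have D: "?D \<in> l2"
      by (intro l2_diff x sA)
    have "complex_of_real ((l2_norm ?D)\<^sup>2) = l2_inner x x - \<gamma> * l2_inner x (A x) -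
        (\<gamma> * l2_inner (A x) x - \<gamma> * \<gamma> * l2_inner (A x) (A x))"
      unfolding l2_inner_self[OF D, symmetric]
      by (subst l2_inner_diff_scale) (simp_all add: x mem)
    then have "(l2_norm ?D)\<^sup>2 = (l2_norm x)\<^sup>2 - 2 * \<gamma> * Re (l2_inner (A x) x) + \<gamma>\<^sup>2 * (l2_norm (A x))\<^sup>2"
      unfolding l2_inner_commute[OF mem[OF x] x] l2_inner_self[OF x] l2_inner_self[OF mem[OF x]]
      by (simp add: complex_eq_iff algebra_simps power2_eq_square)
    also have "\<dots> \<le> (l2_norm x)\<^sup>2 - 2 * \<gamma> * (c * (l2_norm x)\<^sup>2) + \<gamma>\<^sup>2 * (C * l2_norm x)\<^sup>2"
      using \<gamma> coercive[OF x] C_bound[OF x] l2_norm_nonneg[OF mem[OF x]] l2_norm_nonneg[OF x]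
      by (intro add_mono diff_mono mult_left_mono power_mono) auto
    also have "\<dots> = (1 - c\<^sup>2 / C\<^sup>2) * (l2_norm x)\<^sup>2"
      using C by (simp add: \<gamma>_def field_simps power2_eq_square)
    also have "\<dots> = (q * l2_norm x)\<^sup>2"
      by (simp add: q(3) power_mult_distrib)
    finally show ?thesis
      using q l2_norm_nonneg[OF x] by (auto intro: power2_le_imp_le)
  qed
  \<comment> \<open>Richardson iteration for \<open>A z = y\<close>.\<close>
  have surj: "\<exists>z\<in>l2. A z = y" if y: "y \<in> l2" for y
  proof -
    define X where "X = rec_nat (\<lambda>_. 0) (\<lambda>_ x k. x k + \<gamma> * (y k - A x k))"
    have X_0: "X 0 = (\<lambda>_. 0)" and X_Suc: "X (Suc n) = (\<lambda>k. X n k + \<gamma> * (y k - A (X n) k))" for n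
      by (simp_all add: X_def)
    have X: "X n \<in> l2" for n
    proof (induction n)
      case 0
      show ?case
        unfolding X_0 by (simp add: l2_def)
    next
      case (Suc n)
      then show ?case
        unfolding X_Suc by (intro l2_add l2_scale l2_diff y mem)
    qed
    define K where "K = l2_norm (\<lambda>k. X (Suc 0) k - X 0 k)"
    have step: "l2_norm (\<lambda>k. X (Suc n) k - X n k) \<le> K * q ^ n" for n
    proof (induction n)
      case (Suc n)
      \<comment> \<open>The right-hand side \<open>y\<close> cancels in the increments, so each one
        is the image of the previous one under the contraction.\<close>
      have "(\<lambda>k. X (Suc (Suc n)) k - X (Suc n) k) =
          (\<lambda>k. (X (Suc n) k - X n k) - \<gamma> * A (\<lambda>k. X (Suc n) k - X n k) k)"
        unfolding l2_bounded_operator_diff[OF A X X] X_Suc[of "Suc n"]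
        by (subst (3) X_Suc) (auto simp: algebra_simps X_Suc[of n])
      then have "l2_norm (\<lambda>k. X (Suc (Suc n)) k - X (Suc n) k) \<le> q * l2_norm (\<lambda>k. X (Suc n) k - X n k)"
        using contraction[OF l2_diff[OF X X]] by metis
      also have "\<dots> \<le> q * (K * q ^ n)"
        using q by (intro mult_left_mono Suc.IH) auto
      finally show ?case
        by (simp add: mult_ac)
    qed (simp add: K_def)
    obtain z where z: "z \<in> l2" "\<And>n. l2_norm (\<lambda>k. z k - X n k) \<le> K * q ^ n / (1 - q)"
      using l2_complete[OF X q(1,2) step] by blast
    have residual: "l2_norm (\<lambda>k. A z k - y k) \<le> (C * K / (1 - q) + K / \<gamma>) * q ^ n" for n
    proof -
      have "l2_norm (\<lambda>k. A z k - y k) \<le>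
          l2_norm (\<lambda>k. A z k - A (X n) k) + l2_norm (\<lambda>k. A (X n) k - y k)"
        by (intro l2_norm_triangle_diff mem z X y)
      also have "l2_norm (\<lambda>k. A z k - A (X n) k) \<le> C * (K * q ^ n / (1 - q))"
        using C_bound[OF l2_diff[OF z(1) X[of n]]] z(2)[of n] C
        unfolding l2_bounded_operator_diff[OF A z(1) X]
        by (meson less_imp_le mult_left_mono order_trans)
      also have "l2_norm (\<lambda>k. A (X n) k - y k) \<le> K * q ^ n / \<gamma>"
      proof -
        \<comment> \<open>The residual of an iterate is a multiple of the next increment and thus
          decays at the same rate.\<close>
        have "(\<lambda>k. A (X n) k - y k) = (\<lambda>k. complex_of_real (- 1 / \<gamma>) * (X (Suc n) k - X n k))"
          using \<gamma> by (auto simp: X_Suc)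
        then show ?thesis
          using l2_norm_scale[OF l2_diff[OF X X], of "complex_of_real (- 1 / \<gamma>)" "Suc n" n] step[of n] \<gamma>
          by (simp add: norm_divide divide_right_mono)
      qed
      finally show ?thesis
        by (simp add: algebra_simps)
    qed
    have "(\<lambda>n. (C * K / (1 - q) + K / \<gamma>) * q ^ n) \<longlonglongrightarrow> (C * K / (1 - q) + K / \<gamma>) * 0"
      using q by (intro tendsto_intros) auto
    then have "l2_norm (\<lambda>k. A z k - y k) \<le> 0"
      using residual by (intro LIMSEQ_le_const[where X = "\<lambda>n. (C * K / (1 - q) + K / \<gamma>) * q ^ n"]) auto
    then have "A z = y"
      using l2_norm_eq_0[OF l2_diff[OF mem[OF z(1)] y]] by (intro ext) (metis right_minus_eq)
    with z show ?thesis
      by blast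
  qed
  \<comment> \<open>Injectivity on \<open>l2\<close> makes the description unique; outside
    \<open>l2\<close> the value of \<open>B\<close> is irrelevant.\<close>
  define B where "B y = (THE x. x \<in> l2 \<and> A x = y)" for y
  have B_A: "B (A x) = x" if "x \<in> l2" for x
    unfolding B_def using that inj by (intro the_equality) auto
  have B: "B y \<in> l2" "A (B y) = y" if "y \<in> l2" for y
    using surj[OF that] B_A by auto
  have "l2_bounded_operator B"
    unfolding l2_bounded_operator_def
  proof (intro conjI ballI allI exI[of _ "1 / c"])
    fix x y :: "nat \<Rightarrow> complex" and a assume x: "x \<in> l2"
    show "B x \<in> l2" "l2_norm (B x) \<le> 1 / c * l2_norm x"
      using B[OF x] lower[of "B x"] c by (auto simp: field_simps)
    show "B (\<lambda>k. a * x k) = (\<lambda>k. a * B x k)"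
      using B_A[OF l2_scale[OF B(1)[OF x], of a]]
      by (simp add: l2_bounded_operator_scale[OF A B(1)[OF x]] B(2)[OF x])
    assume y: "y \<in> l2"
    show "B (\<lambda>k. x k + y k) = (\<lambda>k. B x k + B y k)"
      using B_A[OF l2_add[OF B(1)[OF x] B(1)[OF y]]]
      by (simp add: l2_bounded_operator_add[OF A B(1)[OF x] B(1)[OF y]] B(2)[OF x] B(2)[OF y])
  qed
  then show ?thesis
    unfolding l2_bounded_inverse_def using B B_A by blast
qed

section \<open>Quadratic forms of hermitian matrices\<close>

text \<open>Restriction of the double limit to square sections M = N, on which finite quadratic form
  estimates apply.\<close>

lemma matrix_defines_l2_operator_diagonal:
  assumes "matrix_defines_l2_operator a A" "x \<in> l2" "y \<in> l2"
  shows "(\<lambda>N. \<Sum>k<N. \<Sum>j<N. a k j * x k * cnj (y j)) \<longlonglongrightarrow> l2_inner (A x) y"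
proof -
  have "((\<lambda>(M, N). \<Sum>k<M. \<Sum>j<N. a k j * x k * cnj (y j)) \<longlongrightarrow> l2_inner (A x) y)
      (sequentially \<times>\<^sub>F sequentially)"
    using assms unfolding matrix_defines_l2_operator_def by blast
  from filterlim_compose[OF this filterlim_Pair[OF filterlim_ident filterlim_ident]] show ?thesis
    by simp
qed

lemma l2_inner_hermitian:
  assumes A: "matrix_defines_l2_operator a A" and a: "\<And>k j. a j k = cnj (a k j)"
    and x: "x \<in> l2" and y: "y \<in> l2"
  shows "l2_inner (A y) x = cnj (l2_inner (A x) y)"
proof (rule LIMSEQ_unique)
  show "(\<lambda>N. \<Sum>k<N. \<Sum>j<N. a k j * y k * cnj (x j)) \<longlonglongrightarrow> l2_inner (A y) x"
    by (rule matrix_defines_l2_operator_diagonal[OF A y x])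
  have "(\<lambda>N. cnj (\<Sum>k<N. \<Sum>j<N. a k j * x k * cnj (y j))) \<longlonglongrightarrow> cnj (l2_inner (A x) y)"
    by (intro tendsto_cnj matrix_defines_l2_operator_diagonal[OF A x y])
  moreover have "cnj (\<Sum>k<N. \<Sum>j<N. a k j * x k * cnj (y j)) =
      (\<Sum>k<N. \<Sum>j<N. a k j * y k * cnj (x j))" for N
    by (subst sum.swap) (simp add: mult_ac flip: a)
  ultimately show "(\<lambda>N. \<Sum>k<N. \<Sum>j<N. a k j * y k * cnj (x j)) \<longlonglongrightarrow> cnj (l2_inner (A x) y)"
    by simp
qed

text \<open>Positivity is tested at \<open>x - (1 / C) A x\<close>.\<close>

lemma l2_norm_power2_le_form:
  assumes A: "l2_bounded_operator A"
    and hermitian: "\<And>x y. x \<in> l2 \<Longrightarrow> y \<in> l2 \<Longrightarrow> l2_inner (A y) x = cnj (l2_inner (A x) y)"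
    and nonneg: "\<And>x. x \<in> l2 \<Longrightarrow> 0 \<le> Re (l2_inner (A x) x)"
    and C: "C > 0" "\<And>x. x \<in> l2 \<Longrightarrow> l2_norm (A x) \<le> C * l2_norm x"
    and x: "x \<in> l2"
  shows "(l2_norm (A x))\<^sup>2 \<le> C * Re (l2_inner (A x) x)"
proof -
  define z where "z = A x"
  define t where "t = complex_of_real (1 / C)"
  have z: "z \<in> l2" and Az: "A z \<in> l2"
    using l2_bounded_operator_mem[OF A] x by (auto simp: z_def)
  have w: "(\<lambda>k. x k - t * z k) \<in> l2"
    using x z by (intro l2_diff l2_scale)
  have "A (\<lambda>k. x k - t * z k) = (\<lambda>k. z k - t * A z k)"
    using l2_bounded_operator_diff[OF A x l2_scale[OF z, of t]]
      l2_bounded_operator_scale[OF A z, of t] by (simp flip: z_def)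
  then have "l2_inner (A (\<lambda>k. x k - t * z k)) (\<lambda>k. x k - t * z k) =
      l2_inner z x - cnj t * l2_inner z z - (t * l2_inner (A z) x - t * cnj t * l2_inner (A z) z)"
    using x z Az by (simp only: l2_inner_diff_scale)
  \<comment> \<open>Self-adjointness moves \<open>A\<close> onto \<open>x\<close>, and
    \<open>z\<close> is \<open>A x\<close>; this is how the squared norm of \<open>A x\<close>
    enters.\<close>
  also have "l2_inner (A z) x = l2_inner z z"
    using hermitian[OF x z] by (simp add: l2_inner_self[OF z] flip: z_def)
  finally have "0 \<le> Re (l2_inner z x - cnj t * l2_inner z z -
      (t * l2_inner z z - t * cnj t * l2_inner (A z) z))"
    using nonneg[OF w] by simp
  also have "\<dots> = Re (l2_inner z x) - 2 / C * (l2_norm z)\<^sup>2 + Re (l2_inner (A z) z) / C\<^sup>2"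
    by (simp add: l2_inner_self[OF z] t_def power2_eq_square algebra_simps)
  also have "Re (l2_inner (A z) z) / C\<^sup>2 \<le> C * (l2_norm z)\<^sup>2 / C\<^sup>2"
  proof (intro divide_right_mono)
    have "Re (l2_inner (A z) z) \<le> l2_norm (A z) * l2_norm z"
      using complex_Re_le_cmod cmod_l2_inner_le[OF Az z] order_trans by blast
    also have "\<dots> \<le> C * l2_norm z * l2_norm z"
      by (intro mult_right_mono C z l2_norm_nonneg)
    finally show "Re (l2_inner (A z) z) \<le> C * (l2_norm z)\<^sup>2"
      by (simp add: power2_eq_square mult.assoc)
  qed simp
  finally have "0 \<le> Re (l2_inner z x) - (l2_norm z)\<^sup>2 / C"
    using C by (simp add: power2_eq_square field_simps)
  then show ?thesis
    using C by (simp add: z_def field_simps)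
qed

section \<open>Gram matrices\<close>

text \<open>In dimension 3 the cube count is cubic in 1/s. The inequality (1 + v)^3 \<le> 4 (1 +
  v^3) for v = 1/s isolates s^-3, the power whose integral is controlled.\<close>

lemma sum_exp_dist_le_cubic:
  fixes X :: "'i \<Rightarrow> real ^ 3"
  assumes d: "d > 0" and sep: "\<And>i j. i \<noteq> j \<Longrightarrow> d \<le> norm (X i - X j)"
  shows "\<exists>C>0. \<forall>s>0. \<forall>I y. finite I \<longrightarrow> (\<Sum>j\<in>I. exp (- (s * norm (X j - y)))) \<le> C * (1 + 1 / s ^ 3)"
proof (intro exI conjI allI impI)
  \<comment> \<open>Chosen so that 1 + (9/d) v \<le> L (1 + v), where 9 is the squared dimension;
    the factor 32 is 2^3 times the 4 of the cubic inequality.\<close>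
  define L where "L = max 1 (9 / d)"
  show "32 * L ^ 3 > 0"
    by (simp add: L_def)
  fix s :: real and I :: "'i set" and y assume s: "s > 0" and I: "finite I"
  define v where "v = 1 / s"
  have v: "v > 0"
    using s by (simp add: v_def)
  have "(\<Sum>j\<in>I. exp (- (s * norm (X j - y)))) \<le> (2 * (1 + 9 / (s * d))) ^ 3"
    using sum_exp_dist_le[of d I X s y] d sep I s by simp
  also have "\<dots> \<le> (2 * (L * (1 + v))) ^ 3"
  proof (intro power_mono mult_left_mono)
    have "1 + 9 / (s * d) = 1 + (9 / d) * v"
      by (simp add: v_def)
    also have "\<dots> \<le> L + L * v"
      using v by (intro add_mono mult_right_mono) (auto simp: L_def)
    finally show "1 + 9 / (s * d) \<le> L * (1 + v)"
      by (simp add: distrib_left)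
  qed (use s d in auto)
  also have "\<dots> = 8 * L ^ 3 * (1 + v) ^ 3"
    by (simp add: power_mult_distrib)
  also have "\<dots> \<le> 8 * L ^ 3 * (4 * (1 + v ^ 3))"
  proof (rule mult_left_mono)
    have "0 \<le> 3 * (1 + v) * (1 - v)\<^sup>2"
      using v by simp
    also have "\<dots> = 4 * (1 + v ^ 3) - (1 + v) ^ 3"
      by (simp add: power2_eq_square power3_eq_cube algebra_simps)
    finally show "(1 + v) ^ 3 \<le> 4 * (1 + v ^ 3)"
      by simp
  qed (simp add: L_def)
  finally show "(\<Sum>j\<in>I. exp (- (s * norm (X j - y)))) \<le> 32 * L ^ 3 * (1 + 1 / s ^ 3)"
    by (simp add: v_def power_one_over algebra_simps)
qed

section \<open>Row sums, coercivity and necessity of separation\<close>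

context laplace_representation
begin

lemma f_nonneg: "t \<ge> 0 \<Longrightarrow> f t \<ge> 0"
  by (simp add: f_eq)

text \<open>The bound C (1 + s^-3) for exponential sums is uniform in the centre, and its integral
  is finite because \<tau> is finite and the hypothesis dominates the integral of s^-3.\<close>

lemma row_sums_bounded:
  fixes X :: "nat \<Rightarrow> real ^ 3"
  assumes sep: "separation X > 0"
    and fin: "(\<integral>\<^sup>+ s. ennreal s + inverse (ennreal s) ^ 3 \<partial>\<tau>) < \<infinity>"
  shows "\<exists>M. \<forall>j n. (\<Sum>k<n. f (norm (X j - X k))) \<le> M"
proof -
  have "\<exists>C>0. \<forall>s>0. \<forall>I y. finite I \<longrightarrow> (\<Sum>j\<in>I. exp (- (s * norm (X j - y)))) \<le> C * (1 + 1 / s ^ 3)"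
    by (rule sum_exp_dist_le_cubic[OF sep separation_le])
  then obtain C where C: "C > 0"
      "\<And>s I y. s > 0 \<Longrightarrow> finite I \<Longrightarrow> (\<Sum>j\<in>I. exp (- (s * norm (X j - y)))) \<le> C * (1 + 1 / s ^ 3)"
    by auto
  define M where "M = (\<integral>\<^sup>+ s. ennreal C * (1 + inverse (ennreal s) ^ 3) \<partial>\<tau>)"
  have meas: "(\<lambda>s. inverse (ennreal s) ^ 3) \<in> borel_measurable \<tau>"
    by (rule borel_measurable_tau) measurable
  have "M = ennreal C * (emeasure \<tau> (space \<tau>) + (\<integral>\<^sup>+ s. inverse (ennreal s) ^ 3 \<partial>\<tau>))"
    unfolding M_def using meas by (simp add: nn_integral_cmult nn_integral_add)
  moreover have "(\<integral>\<^sup>+ s. inverse (ennreal s) ^ 3 \<partial>\<tau>) \<le> (\<integral>\<^sup>+ s. ennreal s + inverse (ennreal s) ^ 3 \<partial>\<tau>)"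
    by (intro nn_integral_mono) simp
  then have "(\<integral>\<^sup>+ s. inverse (ennreal s) ^ 3 \<partial>\<tau>) \<noteq> top"
    using fin by (auto simp: top_unique)
  ultimately have M: "M < top"
    using emeasure_finite[of "space \<tau>"] by (simp add: ennreal_mult_eq_top_iff flip: less_top)
  have "(\<Sum>k<n. f (norm (X j - X k))) \<le> enn2real M" for j n
  proof -
    let ?S = "\<lambda>s. \<Sum>k<n. exp (- (s * norm (X k - X j)))"
    have int: "integrable \<tau> (\<lambda>s. exp (- (s * norm (X k - X j))))" for k
      using integrable_exp[of "norm (X k - X j)"] by (simp add: mult.commute)
    have "f (norm (X j - X k)) = (\<integral>s. exp (- (s * norm (X k - X j))) \<partial>\<tau>)" for k
      by (subst f_eq) (simp_all add: mult.commute norm_minus_commute)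
    then have "(\<Sum>k<n. f (norm (X j - X k))) = (\<integral>s. ?S s \<partial>\<tau>)"
      using int by (simp add: Bochner_Integration.integral_sum)
    then have "ennreal (\<Sum>k<n. f (norm (X j - X k))) = (\<integral>\<^sup>+ s. ennreal (?S s) \<partial>\<tau>)"
      using int by (simp add: nn_integral_eq_integral sum_nonneg)
    also have "\<dots> \<le> M"
      unfolding M_def
    proof (intro nn_integral_mono)
      fix s assume "s \<in> space \<tau>"
      then consider "s = 0" | "s > 0"
        by (force simp: space_tau)
      then show "ennreal (?S s) \<le> ennreal C * (1 + inverse (ennreal s) ^ 3)"
      proof cases
        \<comment> \<open>At s = 0 the inverse in \<open>ennreal\<close> is infinite, so the
          right-hand side is \<open>top\<close>.\<close>
        case 1
        then show ?thesis
          using C by (simp add: ennreal_mult_top)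
      next
        case 2
        have "ennreal (?S s) \<le> ennreal (C * (1 + 1 / s ^ 3))"
          using 2 by (intro ennreal_leI C) auto
        also have "\<dots> = ennreal C * (1 + inverse (ennreal s) ^ 3)"
          using 2 C by (simp add: ennreal_mult inverse_ennreal ennreal_power ennreal_plus
              power_inverse divide_inverse flip: ennreal_1)
        finally show ?thesis .
      qed
    qed
    finally have "ennreal (\<Sum>k<n. f (norm (X j - X k))) \<le> M" .
    then show ?thesis
      using M enn2real_mono[of "ennreal (\<Sum>k<n. f (norm (X j - X k)))" M]
      by (simp add: sum_nonneg f_nonneg)
  qed
  then show ?thesis
    by blast
qed

text \<open>Passes the inequality for finite sections to the operator. A positive \<open>c\<close>
  gives invertibility, and c = 0 gives positivity of \<open>A\<close>.\<close>

lemma gram_form_coercive: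
  fixes X :: "nat \<Rightarrow> real ^ 'n"
  assumes A: "matrix_defines_l2_operator (gram_matrix X f) A"
    and c: "\<And>m \<xi>. complex_of_real (c * (\<Sum>k<m. (cmod (\<xi> k))\<^sup>2)) \<le>
      (\<Sum>j<m. \<Sum>k<m. \<xi> k * cnj (\<xi> j) * complex_of_real (f (norm (X k - X j))))"
    and x: "x \<in> l2"
  shows "c * (l2_norm x)\<^sup>2 \<le> Re (l2_inner (A x) x)"
proof (rule LIMSEQ_le)
  show "(\<lambda>N. Re (\<Sum>k<N. \<Sum>j<N. gram_matrix X f k j * x k * cnj (x j))) \<longlonglongrightarrow> Re (l2_inner (A x) x)"
    by (intro tendsto_Re matrix_defines_l2_operator_diagonal A x)
  show "(\<lambda>N. c * (\<Sum>k<N. (cmod (x k))\<^sup>2)) \<longlonglongrightarrow> c * (l2_norm x)\<^sup>2"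
    unfolding l2_norm_power2[OF x]
    by (intro tendsto_intros summable_LIMSEQ) (use x in \<open>simp add: l2_def\<close>)
  have "(\<Sum>k<N. \<Sum>j<N. gram_matrix X f k j * x k * cnj (x j)) =
      (\<Sum>j<N. \<Sum>k<N. x k * cnj (x j) * complex_of_real (f (norm (X k - X j))))" for N
    by (subst sum.swap) (simp add: gram_matrix_def mult_ac)
  then show "\<exists>N0. \<forall>N\<ge>N0. c * (\<Sum>k<N. (cmod (x k))\<^sup>2) \<le>
      Re (\<Sum>k<N. \<Sum>j<N. gram_matrix X f k j * x k * cnj (x j))"
    using c[where \<xi> = x] by (auto simp: less_eq_complex_def)
qed

lemma gram_matrix_invertible:
  fixes X :: "nat \<Rightarrow> real ^ 3"
  assumes pd: "strongly_positive_definite X (\<lambda>x. complex_of_real (f (norm x)))"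
    and sep: "separation X > 0"
    and fin: "(\<integral>\<^sup>+ s. ennreal s + inverse (ennreal s) ^ 3 \<partial>\<tau>) < \<infinity>"
  shows "\<exists>A. matrix_defines_l2_operator (gram_matrix X f) A \<and> l2_bounded_inverse A"
proof -
  obtain M where M: "\<And>j n. (\<Sum>k<n. f (norm (X j - X k))) \<le> M"
    using row_sums_bounded[OF sep fin] by blast
  have "\<exists>A. matrix_defines_l2_operator (\<lambda>k j. complex_of_real (f (norm (X k - X j)))) A"
    by (rule schur_test[OF _ _ M]) (simp_all add: f_nonneg norm_minus_commute)
  then obtain A where A: "matrix_defines_l2_operator (gram_matrix X f) A"
    unfolding gram_matrix_def[abs_def] by blast
  obtain c where c: "c > 0" "\<And>m \<xi>. complex_of_real (c * (\<Sum>k<m. (cmod (\<xi> k))\<^sup>2)) \<le>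
      (\<Sum>j<m. \<Sum>k<m. \<xi> k * cnj (\<xi> j) * complex_of_real (f (norm (X k - X j))))"
    using pd unfolding strongly_positive_definite_def by blast
  have "l2_bounded_inverse A"
    using A gram_form_coercive[OF A c(2)]
    by (intro l2_bounded_inverseI[OF _ c(1)]) (auto simp: matrix_defines_l2_operator_def)
  with A show ?thesis
    by blast
qed

text \<open>Invertibility and positivity bound the form of \<open>A\<close> below by |x|^2 / (D^2
  C). At a difference of two unit vectors this forces f 0 - f r \<ge> 1 / (D^2 C), which continuity
  at 0 forbids for close points.\<close>

lemma separation_pos_of_invertible:
  fixes X :: "nat \<Rightarrow> real ^ 'n"
  assumes cont: "continuous_on {0..} f"
    and A: "matrix_defines_l2_operator (gram_matrix X f) A" and inv: "l2_bounded_inverse A"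
  shows "separation X > 0"
proof (rule ccontr)
  assume "\<not> separation X > 0"
  note sep = separation_zeroE[OF this]
  have opA: "l2_bounded_operator A"
    using A by (simp add: matrix_defines_l2_operator_def)
  obtain C where C: "C > 0" "\<And>x. x \<in> l2 \<Longrightarrow> l2_norm (A x) \<le> C * l2_norm x"
    using l2_bounded_operatorE[OF opA] by blast
  obtain B where opB: "l2_bounded_operator B" and BA: "\<And>x. x \<in> l2 \<Longrightarrow> B (A x) = x"
    using inv unfolding l2_bounded_inverse_def by blast
  obtain D where D: "D > 0" "\<And>x. x \<in> l2 \<Longrightarrow> l2_norm (B x) \<le> D * l2_norm x"
    using l2_bounded_operatorE[OF opB] by blast
  have le: "(l2_norm x)\<^sup>2 \<le> D\<^sup>2 * C * Re (l2_inner (A x) x)" if x: "x \<in> l2" for x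
  proof -
    have "l2_norm x \<le> D * l2_norm (A x)"
      using D(2)[OF l2_bounded_operator_mem[OF opA x]] BA[OF x] by simp
    then have "(l2_norm x)\<^sup>2 \<le> D\<^sup>2 * (l2_norm (A x))\<^sup>2"
      using power_mono[OF _ l2_norm_nonneg[OF x], of _ 2] by (simp flip: power_mult_distrib)
    also have "(l2_norm (A x))\<^sup>2 \<le> C * Re (l2_inner (A x) x)"
    proof (rule l2_norm_power2_le_form[OF opA _ _ C x])
      show "l2_inner (A v) u = cnj (l2_inner (A u) v)" if "u \<in> l2" "v \<in> l2" for u v
        by (rule l2_inner_hermitian[OF A _ that]) (simp add: gram_matrix_def norm_minus_commute)
      show "0 \<le> Re (l2_inner (A u) u)" if "u \<in> l2" for u
        using gram_form_coercive[OF A _ that, of 0] positive_definite_norm[OF cont, where 'n = 'n]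
        by (simp add: positive_definite_def)
    qed
    finally show ?thesis
      using D(1) by (simp add: mult_left_mono mult.assoc)
  qed
  have "1 / (D\<^sup>2 * C) > 0"
    using C D by simp
  \<comment> \<open>The threshold is exactly the gap that the lower bound on the form would force
    between \<open>f 0\<close> and \<open>f r\<close>.\<close>
  then obtain \<delta> where \<delta>: "\<delta> > 0" "\<And>r. r \<ge> 0 \<Longrightarrow> r < \<delta> \<Longrightarrow> \<bar>f r - f 0\<bar> < 1 / (D\<^sup>2 * C)"
    using cont[unfolded continuous_on_iff, rule_format, of 0 "1 / (D\<^sup>2 * C)"]
    by (auto simp: dist_real_def)
  obtain i j where ij: "i \<noteq> j" "norm (X i - X j) < \<delta>"
    using sep[OF \<delta>(1)] by blast
  define r where "r = norm (X i - X j)"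
  \<comment> \<open>The difference of the unit vectors at \<open>i\<close> and \<open>j\<close>; its
    squared norm is at least 2 since the indices differ, even if the points coincide.\<close>
  define x :: "nat \<Rightarrow> complex" where "x k = (if k = i then 1 else 0) - (if k = j then 1 else 0)" for k
  have x: "x \<in> l2"
    by (rule l2_eq_0_beyond[of "Suc (max i j)"]) (auto simp: x_def)
  have sum_x: "(\<Sum>k<N. g k * x k) = g i - g j" if "N > max i j" for N g
    using that by (simp add: x_def right_diff_distrib sum_subtractf if_distrib[of "(*) _"] cong: if_cong)
  have "(\<lambda>N. \<Sum>k<N. \<Sum>l<N. gram_matrix X f k l * x k * cnj (x l)) \<longlonglongrightarrow>
      complex_of_real (2 * (f 0 - f r))"
  proof (rule tendsto_eventually, rule eventually_sequentiallyI)
    fix N assume "N \<ge> Suc (max i j)"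
    then have N: "N > max i j"
      by linarith
    have "cnj (x l) = x l" for l
      by (simp add: x_def)
    then have "(\<Sum>k<N. \<Sum>l<N. gram_matrix X f k l * x k * cnj (x l)) =
        (\<Sum>k<N. (\<Sum>l<N. gram_matrix X f k l * x l) * x k)"
      by (simp add: sum_distrib_left sum_distrib_right mult_ac)
    also have "\<dots> = complex_of_real (2 * (f 0 - f r))"
      by (simp add: sum_x[OF N] gram_matrix_def r_def norm_minus_commute)
    finally show "(\<Sum>k<N. \<Sum>l<N. gram_matrix X f k l * x k * cnj (x l)) =
        complex_of_real (2 * (f 0 - f r))" .
  qed
  then have "l2_inner (A x) x = complex_of_real (2 * (f 0 - f r))"
    by (rule LIMSEQ_unique[OF matrix_defines_l2_operator_diagonal[OF A x x]])
  moreover have "2 \<le> (l2_norm x)\<^sup>2"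
  proof -
    have "sqrt 2 \<le> l2_norm x"
      using L2_set_le_l2_norm[OF x, of "{i, j}"] ij(1) by (simp add: x_def L2_set_def)
    then show ?thesis
      using power_mono[of "sqrt 2" "l2_norm x" 2] by simp
  qed
  ultimately have "2 \<le> D\<^sup>2 * C * (2 * (f 0 - f r))"
    using le[OF x] by simp
  moreover have "D\<^sup>2 * C * (f 0 - f r) < D\<^sup>2 * C * (1 / (D\<^sup>2 * C))"
    using \<delta>(2)[of r] ij(2) C D by (intro mult_strict_left_mono) (auto simp: r_def)
  ultimately show False
    using C D by (simp add: algebra_simps)
qed

end

theorem theorem2p10:
  fixes f :: "real \<Rightarrow> real" and \<tau> :: "real measure" and X :: "nat \<Rightarrow> real ^ 3"
  assumes "f \<in> completely_monotone"
    and "\<not> f constant_on {0..}"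
    and "sets \<tau> = sets (restrict_space borel {0..})"
    and "finite_measure \<tau>"
    and "\<And>t. t \<ge> 0 \<Longrightarrow> f t = (\<integral>s. exp (- (t * s)) \<partial>\<tau>)"
  shows "(separation X > 0 \<longrightarrow>
            strongly_positive_definite X (\<lambda>x. complex_of_real (f (norm x)))) \<and>
         (separation X > 0 \<and>
            (\<integral>\<^sup>+ s. ennreal s + inverse (ennreal s) ^ 3 \<partial>\<tau>) < \<infinity> \<longrightarrow>
            (\<exists>A. matrix_defines_l2_operator (gram_matrix X f) A \<and> l2_bounded_inverse A)) \<and>
         ((\<exists>A. matrix_defines_l2_operator (gram_matrix X f) A \<and> l2_bounded_inverse A) \<longrightarrow>
            separation X > 0)"
proof -
  interpret laplace_representation \<tau> f
    using assms(3-5) by (intro laplace_representation.intro laplace_representation_axioms.intro)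
  have cont: "continuous_on {0..} f"
    using assms(1) by (simp add: completely_monotone_def)
  have "strongly_positive_definite X (\<lambda>x. complex_of_real (f (norm x)))" if "separation X > 0"
    using cont assms(2) that by (rule strongly_positive_definite_norm)
  then show ?thesis
    using gram_matrix_invertible[of X] separation_pos_of_invertible[OF cont] by blast
qed

end
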